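(* Let $\mathfrak{F}\subseteq\mathfrak{F}_{\mathrm{all}}$ satisfy $\mathfrak{F}\supseteq\mathfrak{F}_{\mathrm{AR}(2)}^{ext}$ and suppose that the polynomial trend assumption holds: $X=(F,\tilde X)$, where $F$ is $n\times k_F$-dimensional ($1\le k_F\le k$) with $j$-th column $(1^{j-1},\ldots,n^{j-1})'$, where $\tilde X$ is an $n\times(k-k_F)$-dimensional matrix such that $X$ has rank $k$ ($\tilde X$ is the empty matrix if $k_F=k$), and the restriction matrix $R$ has a nonzero column $R_{\cdot i}$ for some $i\in\{1,\ldots,k_F\}$. Suppose that the real $n\times n$ matrix $\mathcal{W}$ is constant (does not depend on $y\in\mathbb{R}^n$) and symmetric, that $\Pi_{\mathrm{span}(X)^\perp}\mathcal{W}\Pi_{\mathrm{span}(X)^\perp}$ is nonzero, and that $c\in\mathbb{R}$. Furthermore, for the statements that involve $U$, suppose $U$ is an $n\times m$-dimensional matrix with $m\ge1$ such that $(X,U)$ is of full column-rank $k+m<n$. Then $\check\beta=\hat\beta$ and $\check\Omega=\check\Omega_{\mathcal{W},c}^{\mathrm{BV}}$ (respectively, $\check\beta=\hat\beta$ and $\check\Omega=\check\Omega_{\mathcal{W},U,c}^{\mathrm{BV},J}$) satisfy the estimator conditions with $N=\mathrm{span}(X)$ (respectively, $N=\mathrm{span}(X,U)$). Let $T$ be the nonsphericity-corrected F-type test statistic with $\check\beta=\hat\beta$, $\check\Omega=\check\Omega_{\mathcal{W},c}^{\mathrm{BV}}$, and $N=\mathrm{span}(X)$, or with $\check\beta=\hat\beta$,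 $\check\Omega=\check\Omega_{\mathcal{W},U,c}^{\mathrm{BV},J}$, and $N=\mathrm{span}(X,U)$. Then $$P_{0,I_n}(\hat\omega_{\mathcal{W}}\ge0)\le\sup_{f\in\mathfrak{F}}P_{\mu_0,\sigma^2\Sigma(f)}(T\ge C)$$ holds for every critical value $C$, $-\infty<C<\infty$, for every $\mu_0\in\mathfrak{M}_0$, and for every $\sigma^2\in(0,\infty)$. The lower bound equals $1$ in case $\Pi_{\mathrm{span}(X)^\perp}\mathcal{W}\Pi_{\mathrm{span}(X)^\perp}$ is nonnegative definite. Furthermore, for every $0\le C<\infty$, $$\sup_{\mu_1\in\mathfrak{M}_1}\sup_{0<\sigma^2<\infty}P_{\mu_1,\sigma^2I_n}(T\ge C)\le P_{0,I_n}(\hat\omega_{\mathcal{W}}\ge0).$$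
   Context: Model: $n,k,q$ are positive integers with $1\le k<n$; $X\in\mathbb{R}^{n\times k}$ is a fixed matrix of rank $k$; $R\in\mathbb{R}^{q\times k}$ has rank $q\ge 1$; $r\in\mathbb{R}^q$. (One tests $R\beta=r$ against $R\beta\ne r$ in $\mathbf{Y}=X\beta+\mathbf{U}$, $\mathbf{U}\sim N(0,\sigma^2\Sigma(f))$, $0<\sigma^2<\infty$, $f\in\mathfrak{F}$.) $'$ is transpose, $\mathrm{span}(\cdot)$ is column space, $\Pi_{\mathcal{L}}$ is orthogonal projection onto $\mathcal{L}$, $\mathfrak{M}_0=\{X\beta:R\beta=r\}$, $\mathfrak{M}_1=\{X\beta:R\beta\ne r\}$; for $Z$ of full column rank $\hat\beta_Z(y)=(Z'Z)^{-1}Z'y$; $\hat\beta=\hat\beta_X$, $\hat u(y)=y-X\hat\beta(y)$. $P_{\mu,B}$ is the Gaussian measure on $\mathbb{R}^n$ with mean $\mu$ and covariance $B$; $P(T\ge C)$ means $P(\{y:T(y)\ge C\})$, similarly $P(\hat\omega_{\mathcal{W}}\ge 0)$. $\lambda_{\mathbb{R}^n}$ is Lebesgue measure. Spectral densities: $\mathfrak{F}_{\mathrm{all}}$ is the set of all normalized spectral densities of real weakly stationary processes (nonnegative, even, integrable $f$ on $[-\pi,\pi]$ with $\int_{-\pi}^{\pi}f=1$); $\mathfrak{F}_{\mathrm{AR}(2)}$ is the subset of those corresponding to stationary autoregressive processes of order at most two; $\mathfrak{F}_{\mathrm{AR}(2)}^{ext}$ is the set of all $c_1f+(2\pi)^{-1}c_2$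 with $f\in\mathfrak{F}_{\mathrm{AR}(2)}$, $c_1,c_2\ge0$, $c_1+c_2=1$; $\Sigma(f)=\left[\int_{-\pi}^{\pi}e^{-\iota(j-l)\omega}f(\omega)d\omega\right]_{j,l=1}^n$, $\iota$ the imaginary unit. Covariance estimators: $\hat\omega_{\mathcal{W}}(y)=n^{-1}\hat u'(y)\mathcal{W}\hat u(y)$, $$\check\Omega_{\mathcal{W},U,c}^{\mathrm{BV},J}(y)=\hat\omega_{\mathcal{W}}(y)\exp(cJ_{n,U}^1(y))R(X'X)^{-1}R',$$ $$\check\Omega_{\mathcal{W},c}^{\mathrm{BV}}(y)=\hat\omega_{\mathcal{W}}(y)\exp\left(cn^{-2}\frac{\hat u'(y)A'A\hat u(y)}{\hat u'(y)\hat u(y)}\right)R(X'X)^{-1}R',$$ where $A$ is the $n\times n$ matrix with $0$ above the main diagonal and $1$ on and below it, $G=(0,I_m)\in\mathbb{R}^{m\times(k+m)}$, $s_{I_n,(X,U)}^2(y)=n^{-1}y'\Pi_{\mathrm{span}(X,U)^\perp}y$, and $$J_{n,U}^1(y)=n^{-1}\hat\beta_{(X,U)}'(y)G'\left(s_{I_n,(X,U)}^2(y)G((X,U)'(X,U))^{-1}G'\right)^{-1}G\hat\beta_{(X,U)}(y).$$ Estimator conditions on $(\check\beta,\check\Omega,N)$: (i) $\check\beta:\mathbb{R}^n\setminus N\to\mathbb{R}^k$ and $\check\Omega:\mathbb{R}^n\setminus N\to\mathbb{R}^{q\times q}$ are well-defined and continuous on $\mathbb{R}^n\setminus N$, where $N$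 is a closed $\lambda_{\mathbb{R}^n}$-null set, and $\check\Omega(y)$ is symmetric for every $y\in\mathbb{R}^n\setminus N$; (ii) $y\in\mathbb{R}^n\setminus N$ implies $\delta y+X\eta\in\mathbb{R}^n\setminus N$ for all $\delta\ne0$, $\eta\in\mathbb{R}^k$; (iii) $\check\beta(\delta y+X\eta)=\delta\check\beta(y)+\eta$ and $\check\Omega(\delta y+X\eta)=\delta^2\check\Omega(y)$ for all $y\in\mathbb{R}^n\setminus N$, $\delta\neq0$, $\eta\in\mathbb{R}^k$; (iv) $\check\Omega$ is $\lambda_{\mathbb{R}^n}$-almost everywhere nonsingular on $\mathbb{R}^n\setminus N$. Nonsphericity-corrected F-type test statistic: with $N^*=N\cup\{y\in\mathbb{R}^n\setminus N:\det\check\Omega(y)=0\}$, $T(y)=(R\check\beta(y)-r)'\check\Omega^{-1}(y)(R\check\beta(y)-r)$ for $y\in\mathbb{R}^n\setminus N^*$ and $T(y)=0$ for $y\in N^*$. *)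

theory Defs
  imports "HOL-Probability.Probability"
begin

text \<open>Vectors in Euclidean \<open>n\<close>-space have type \<open>real ^ 'n\<close> with \<open>n = CARD('n)\<close>. Where the
  numbering of coordinates matters, the index type is linearly ordered and \<open>pos i\<close>, which ranges
  over \<open>1, \<dots>, n\<close>, is the number of the coordinate \<open>i\<close>.\<close>

definition pos :: "'n::{finite,linorder} \<Rightarrow> nat" where
  "pos i = card {j. j \<le> i}"

definition colspan :: "real ^ 'k ^ 'n \<Rightarrow> (real ^ 'n) set" where
  "colspan Z = span (columns Z)"

definition orth_proj :: "(real ^ 'n) set \<Rightarrow> real ^ 'n \<Rightarrow> real ^ 'n" where
  "orth_proj L x = (THE p. p \<in> L \<and> x - p \<in> L\<^sup>\<bottom>)"

definition proj_matrix :: "(real ^ 'n) set \<Rightarrow> real ^ 'n ^ 'n" where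
  "proj_matrix L = matrix (orth_proj L)"

definition nonneg_definite :: "real ^ 'n ^ 'n \<Rightarrow> bool" where
  "nonneg_definite B \<longleftrightarrow> (\<forall>x. 0 \<le> x \<bullet> (B *v x))"

definition hat_beta :: "real ^ 'k ^ 'n \<Rightarrow> real ^ 'n \<Rightarrow> real ^ 'k" where
  "hat_beta Z y = matrix_inv (transpose Z ** Z) *v (transpose Z *v y)"

definition hat_u :: "real ^ 'k ^ 'n \<Rightarrow> real ^ 'n \<Rightarrow> real ^ 'n" where
  "hat_u X y = y - X *v hat_beta X y"

definition M0 :: "real ^ 'k ^ 'n \<Rightarrow> real ^ 'k ^ 'q \<Rightarrow> real ^ 'q \<Rightarrow> (real ^ 'n) set" where
  "M0 X R r = {X *v \<beta> | \<beta>. R *v \<beta> = r}"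

definition M1 :: "real ^ 'k ^ 'n \<Rightarrow> real ^ 'k ^ 'q \<Rightarrow> real ^ 'q \<Rightarrow> (real ^ 'n) set" where
  "M1 X R r = {X *v \<beta> | \<beta>. R *v \<beta> \<noteq> r}"

text \<open>The first \<open>kF\<close> columns of \<open>X\<close> are the polynomial trend; the others are arbitrary.\<close>

definition polynomial_trend ::
    "real ^ 'k::{finite,linorder} ^ 'n::{finite,linorder} \<Rightarrow>
     real ^ 'k::{finite,linorder} ^ 'q \<Rightarrow> nat \<Rightarrow> bool" where
  "polynomial_trend X R kF \<longleftrightarrow>
     1 \<le> kF \<and> kF \<le> CARD('k) \<and>
     (\<forall>i j. pos j \<le> kF \<longrightarrow> X $ i $ j = real (pos i) ^ (pos j - 1)) \<and>
     (\<exists>i. pos i \<le> kF \<and> column i R \<noteq> 0)"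

definition std_gaussian :: "(real ^ 'n) measure" where
  "std_gaussian = density lborel (\<lambda>z. ennreal (\<Prod>i\<in>UNIV. std_normal_density (z $ i)))"

text \<open>The law of \<open>\<mu> + A z\<close> with \<open>z\<close> standard Gaussian and \<open>A A' = B\<close>. Such an \<open>A\<close> exists whenever
  \<open>B\<close> is symmetric and nonnegative definite, and the law depends on \<open>A\<close> only through \<open>A A'\<close>.\<close>

definition gaussian :: "real ^ 'n \<Rightarrow> real ^ 'n ^ 'n \<Rightarrow> (real ^ 'n) measure" where
  "gaussian \<mu> B =
     distr std_gaussian borel (\<lambda>z. \<mu> + (SOME A :: real ^ 'n ^ 'n. A ** transpose A = B) *v z)"

text \<open>A function on \<open>[-\<pi>, \<pi>]\<close> is represented by its extension by \<open>0\<close> to the real line.\<close>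

definition F_all :: "(real \<Rightarrow> real) set" where
  "F_all = {f. (\<forall>\<omega>. \<omega> \<notin> {-pi..pi} \<longrightarrow> f \<omega> = 0) \<and> (\<forall>\<omega>. 0 \<le> f \<omega>) \<and> (\<forall>\<omega>. f (- \<omega>) = f \<omega>) \<and>
               f absolutely_integrable_on {-pi..pi} \<and> integral {-pi..pi} f = 1}"

text \<open>The spectral density of \<open>Y\<^sub>t = a\<^sub>1 Y\<^bsub>t-1\<^esub> + a\<^sub>2 Y\<^bsub>t-2\<^esub> + \<epsilon>\<^sub>t\<close> with innovation variance \<open>v\<close>.\<close>

definition ar2_density :: "real \<Rightarrow> real \<Rightarrow> real \<Rightarrow> real \<Rightarrow> real" where
  "ar2_density v a1 a2 \<omega> =
     (if \<omega> \<in> {-pi..pi}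
      then v / (2 * pi) / (cmod (1 - of_real a1 * exp (- \<i> * of_real \<omega>)
                                   - of_real a2 * exp (- 2 * \<i> * of_real \<omega>)))\<^sup>2
      else 0)"

text \<open>Stationarity is imposed by keeping the roots of the autoregressive polynomial outside the
  closed unit disc. Excluding only roots on the unit circle gives the same densities: reflecting
  roots at the circle changes the density by a constant factor. Coefficients may vanish, so
  orders 0 and 1 are included.\<close>

definition F_AR2 :: "(real \<Rightarrow> real) set" where
  "F_AR2 = {f \<in> F_all. \<exists>v a1 a2. v > 0 \<and>
      (\<forall>z::complex. cmod z \<le> 1 \<longrightarrow> 1 - of_real a1 * z - of_real a2 * z\<^sup>2 \<noteq> 0) \<and>
      f = ar2_density v a1 a2}"

definition F_AR2_ext :: "(real \<Rightarrow> real) set" where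
  "F_AR2_ext = {(\<lambda>\<omega>. if \<omega> \<in> {-pi..pi} then c1 * f \<omega> + c2 / (2 * pi) else 0) | c1 c2 f.
      f \<in> F_AR2 \<and> 0 \<le> c1 \<and> 0 \<le> c2 \<and> c1 + c2 = 1}"

text \<open>The integrals are real because \<open>f\<close> is even, so \<open>Re\<close> is only a type conversion.\<close>

definition Sigma_f :: "(real \<Rightarrow> real) \<Rightarrow> real ^ 'n::{finite,linorder} ^ 'n::{finite,linorder}" where
  "Sigma_f f = (\<chi> j l. Re (integral {-pi..pi}
     (\<lambda>\<omega>. exp (- \<i> * of_real ((real (pos j) - real (pos l)) * \<omega>)) * of_real (f \<omega>))))"

definition omega_hat :: "real ^ 'k ^ 'n \<Rightarrow> real ^ 'n ^ 'n \<Rightarrow> real ^ 'n \<Rightarrow> real" where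
  "omega_hat X W y = (hat_u X y \<bullet> (W *v hat_u X y)) / real CARD('n)"

definition A_mat :: "real ^ 'n::{finite,linorder} ^ 'n::{finite,linorder}" where
  "A_mat = (\<chi> i j. if j \<le> i then 1 else 0)"

definition Omega_BV ::
    "real ^ 'k ^ 'n::{finite,linorder} \<Rightarrow> real ^ 'k ^ 'q \<Rightarrow>
     real ^ 'n::{finite,linorder} ^ 'n::{finite,linorder} \<Rightarrow> real \<Rightarrow>
     real ^ 'n::{finite,linorder} \<Rightarrow> real ^ 'q ^ 'q" where
  "Omega_BV X R W c y =
     (omega_hat X W y *
      exp (c * (1 / (real CARD('n))\<^sup>2) *
           ((hat_u X y \<bullet> ((transpose A_mat ** A_mat) *v hat_u X y)) / (hat_u X y \<bullet> hat_u X y))))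
     *\<^sub>R (R ** matrix_inv (transpose X ** X) ** transpose R)"

definition append_cols ::
    "real ^ 'k::finite ^ 'n \<Rightarrow> real ^ 'm::finite ^ 'n \<Rightarrow> real ^ ('k::finite + 'm::finite) ^ 'n" where
  "append_cols X U = (\<chi> i j. case j of Inl a \<Rightarrow> X $ i $ a | Inr b \<Rightarrow> U $ i $ b)"

definition G_mat :: "real ^ ('k::finite + 'm::finite) ^ 'm::finite" where
  "G_mat = (\<chi> i j. case j of Inl a \<Rightarrow> 0 | Inr b \<Rightarrow> if b = i then 1 else 0)"

definition s2 :: "real ^ 'l ^ 'n \<Rightarrow> real ^ 'n \<Rightarrow> real" where
  "s2 Z y = (y \<bullet> (proj_matrix ((colspan Z)\<^sup>\<bottom>) *v y)) / real CARD('n)"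

definition J_mid ::
    "real ^ 'k ^ 'n \<Rightarrow> real ^ 'm ^ 'n \<Rightarrow> real ^ 'n \<Rightarrow> real ^ 'm ^ 'm" where
  "J_mid X U y =
     (let Z = append_cols X U; G = (G_mat :: real ^ ('k + 'm) ^ 'm)
      in s2 Z y *\<^sub>R (G ** matrix_inv (transpose Z ** Z) ** transpose G))"

definition J_stat :: "real ^ 'k ^ 'n \<Rightarrow> real ^ 'm ^ 'n \<Rightarrow> real ^ 'n \<Rightarrow> real" where
  "J_stat X U y =
     (let b = (G_mat :: real ^ ('k + 'm) ^ 'm) *v hat_beta (append_cols X U) y
      in (b \<bullet> (matrix_inv (J_mid X U y) *v b)) / real CARD('n))"

definition Omega_BV_J ::
    "real ^ 'k ^ 'n \<Rightarrow> real ^ 'k ^ 'q \<Rightarrow> real ^ 'n ^ 'n \<Rightarrow> real ^ 'm ^ 'n \<Rightarrow> real \<Rightarrow>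
     real ^ 'n \<Rightarrow> real ^ 'q ^ 'q" where
  "Omega_BV_J X R W U c y =
     (omega_hat X W y * exp (c * J_stat X U y))
     *\<^sub>R (R ** matrix_inv (transpose X ** X) ** transpose R)"

text \<open>HOL functions are total, so well-definedness of the estimators has to be expressed
  separately: these are the sets of all \<open>y\<close> at which every division and every matrix inverse in
  the OLS estimator and the respective covariance estimator makes sense.\<close>

definition dom_BV :: "real ^ 'k ^ 'n \<Rightarrow> (real ^ 'n) set" where
  "dom_BV X = {y. invertible (transpose X ** X) \<and> hat_u X y \<bullet> hat_u X y \<noteq> 0}"

definition dom_BV_J :: "real ^ 'k ^ 'n \<Rightarrow> real ^ 'm ^ 'n \<Rightarrow> (real ^ 'n) set" where
  "dom_BV_J X U = {y. invertible (transpose X ** X) \<and>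
     invertible (transpose (append_cols X U) ** append_cols X U) \<and> invertible (J_mid X U y)}"

text \<open>\<open>D\<close> is the set on which \<open>beta\<close> and \<open>Omega\<close> are well-defined.\<close>

definition estimator_conditions ::
    "real ^ 'k ^ 'n \<Rightarrow> (real ^ 'n) set \<Rightarrow> (real ^ 'n \<Rightarrow> real ^ 'k) \<Rightarrow>
     (real ^ 'n \<Rightarrow> real ^ 'q ^ 'q) \<Rightarrow> (real ^ 'n) set \<Rightarrow> bool" where
  "estimator_conditions X D beta Omega N \<longleftrightarrow>
     (- N \<subseteq> D \<and> continuous_on (- N) beta \<and> continuous_on (- N) Omega \<and>
      closed N \<and> N \<in> null_sets lborel \<and>
      (\<forall>y. y \<notin> N \<longrightarrow> transpose (Omega y) = Omega y)) \<and>
     (\<forall>y \<delta> \<eta>. y \<notin> N \<and> \<delta> \<noteq> 0 \<longrightarrow> \<delta> *\<^sub>R y + X *v \<eta> \<notin> N) \<and>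
     (\<forall>y \<delta> \<eta>. y \<notin> N \<and> \<delta> \<noteq> 0 \<longrightarrow>
        beta (\<delta> *\<^sub>R y + X *v \<eta>) = \<delta> *\<^sub>R beta y + \<eta> \<and>
        Omega (\<delta> *\<^sub>R y + X *v \<eta>) = \<delta>\<^sup>2 *\<^sub>R Omega y) \<and>
     (AE y in lborel. y \<notin> N \<longrightarrow> det (Omega y) \<noteq> 0)"

definition T_stat ::
    "real ^ 'k ^ 'q \<Rightarrow> real ^ 'q \<Rightarrow> (real ^ 'n \<Rightarrow> real ^ 'k) \<Rightarrow>
     (real ^ 'n \<Rightarrow> real ^ 'q ^ 'q) \<Rightarrow> (real ^ 'n) set \<Rightarrow> real ^ 'n \<Rightarrow> real" where
  "T_stat R r beta Omega N y =
     (if y \<in> N \<or> det (Omega y) = 0 then 0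
      else (R *v beta y - r) \<bullet> (matrix_inv (Omega y) *v (R *v beta y - r)))"

end

theory Submission
  imports Defs "HOL-Real_Asymp.Real_Asymp"
begin

text \<open>Almost everywhere \<open>T\<close> is a nonnegative quadratic form in \<open>R \<beta> - r\<close> divided by a function with the
  sign of \<open>\<omega>\<close>, and \<open>\<omega>\<close> does not change its sign under scaling and translation along
  \<open>span X\<close>; this gives the power bound. For the size bound take \<open>(1 - s) f + s / (2 \<pi>)\<close>, where \<open>f\<close> is an AR(2)
  density with roots so close to \<open>exp (\<plusminus> \<i> \<theta>)\<close> that \<open>\<Sigma>(f)\<close> almost equals the matrix of
  \<open>cos ((j - l) \<theta>)\<close>. As \<open>\<theta> \<rightarrow> 0\<close>, Taylor expansion shows that this matrix contributes
  \<open>O(\<theta>^(2 kF))\<close> to the covariance of the residuals, which are orthogonal to the trend, but at least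
  a multiple of \<open>\<theta>^(2 l)\<close> for some \<open>l < kF\<close> to the variance of a suitable linear function of
  \<open>R \<beta>\<close>. With the intermediate noise level \<open>s = \<theta>^(2 kF - 1)\<close>, the residuals divided by
  \<open>sqrt s\<close> behave like those of white noise while the numerator of \<open>T\<close> divided by \<open>s\<close> tends to
  infinity. So \<open>T\<close> tends to infinity wherever the limiting \<open>\<omega>\<close> is positive, and Fatou's lemma
  applies.\<close>

text \<open>The obstacle is the choice of a factor in \<open>gaussian\<close>: covariances are
  known, but their factors \<open>A m\<close> are not, and close covariances may have distant
  factors. Convergence of the scaled residual covariances to the projection \<open>P\<close>
  therefore does not make the scaled residuals of \<open>A m *v z\<close> converge for fixed
  \<open>z\<close>, as a pathwise argument requires. Compactness helps: along a subsequence the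
  scaled residual factors converge to some \<open>B\<close> with
  \<open>B ** transpose B = P\<close>; such a \<open>B\<close> is \<open>P ** Q\<close> with
  \<open>Q\<close> orthogonal, and the standard Gaussian law does not see \<open>Q\<close>. The
  numerator diverges, but the direction of the functional of \<open>z\<close> behind it converges
  along the same subsequence, so divergence holds for every \<open>z\<close> off a hyperplane. The
  odd exponent of s comes from parity: squared trigonometric polynomials have even orders in
  \<theta>, at least 2 kF on residuals and at most 2 kF - 2 on the contrast, and 2 kF - 1 lies
  between.\<close>

declare transpose_matrix_vector [simp del]

section \<open>Gaussian measures and null sets\<close>

text \<open>The Fubini argument for uniqueness of Haar measure: the image measure is translation invariant,
  hence a multiple of Lebesgue measure, and the factor is read off the unit ball.\<close>

lemma lborel_distr_orthogonal:
  fixes f :: "'a::euclidean_space \<Rightarrow> 'a"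
  assumes f: "orthogonal_transformation f"
  shows "distr lborel borel f = lborel"
proof (rule measure_eqI)
  obtain g where g: "orthogonal_transformation g" "\<And>x. g (f x) = x" "\<And>x. f (g x) = x"
    using orthogonal_transformation_inv[OF f] orthogonal_transformation_bij[OF f]
    by (metis bij_inv_eq_iff)
  have lin: "linear f" "linear g"
    using f g orthogonal_transformation_linear by auto
  have [measurable]: "f \<in> borel_measurable borel" "g \<in> borel_measurable borel"
    using lin by (auto intro!: borel_measurable_continuous_onI linear_continuous_on simp: linear_conv_bounded_linear)
  let ?M = "distr lborel borel f"
  fix S assume "S \<in> sets ?M"
  then have S[measurable]: "S \<in> sets borel" by simp
  let ?B = "ball (0::'a) 1"
  let ?i = "indicator :: 'a set \<Rightarrow> 'a \<Rightarrow> ennreal"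
  have [measurable]: "?B \<in> sets borel" by simp
  have transl: "(\<integral>\<^sup>+x. h (y + x) \<partial>lborel) = (\<integral>\<^sup>+x. h x \<partial>lborel)"
    if [measurable]: "h \<in> borel_measurable borel" for h and y :: 'a
    using nn_integral_distr[of "\<lambda>x. y + x" lborel borel h] lborel_distr_plus[of y] by simp
  have refl: "(\<integral>\<^sup>+x. h (- x) \<partial>lborel) = (\<integral>\<^sup>+x. h x \<partial>lborel)"
    if [measurable]: "h \<in> borel_measurable borel" for h :: "'a \<Rightarrow> ennreal"
  proof -
    have "distr lborel borel (\<lambda>x::'a. 0 + (\<Sum>j\<in>Basis. (- 1 * (x \<bullet> j)) *\<^sub>R j)) = lborel"
      using lborel_affine_euclidean[of "\<lambda>_. - 1" "0::'a"] by (simp add: density_1 del: scaleR_minus_left)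
    moreover have "(\<lambda>x::'a. 0 + (\<Sum>j\<in>Basis. (- 1 * (x \<bullet> j)) *\<^sub>R j)) = uminus"
      by (simp add: fun_eq_iff sum_negf euclidean_representation)
    ultimately have "distr lborel borel (uminus :: 'a \<Rightarrow> 'a) = lborel" by simp
    then show ?thesis using nn_integral_distr[of "\<lambda>x::'a. - x" lborel borel h] by simp
  qed
  have "emeasure ?M S * emeasure lborel ?B = (\<integral>\<^sup>+x. (\<integral>\<^sup>+y. ?i S (f x) * ?i ?B y \<partial>lborel) \<partial>lborel)"
  proof -
    have "emeasure ?M S = (\<integral>\<^sup>+x. ?i S (f x) \<partial>lborel)"
      using nn_integral_distr[of f lborel borel "?i S"] by simp
    moreover have "(\<integral>\<^sup>+y. ?i S (f x) * ?i ?B y \<partial>lborel) = ?i S (f x) * emeasure lborel ?B" for x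
      by (rule nn_integral_cmult_indicator) simp
    ultimately show ?thesis
      by (simp add: nn_integral_multc)
  qed
  also have "\<dots> = (\<integral>\<^sup>+x. (\<integral>\<^sup>+y. ?i S (f x) * ?i ?B (f x + y) \<partial>lborel) \<partial>lborel)"
  proof (rule nn_integral_cong)
    fix x
    show "(\<integral>\<^sup>+y. ?i S (f x) * ?i ?B y \<partial>lborel) = (\<integral>\<^sup>+y. ?i S (f x) * ?i ?B (f x + y) \<partial>lborel)"
      by (rule transl[of "\<lambda>y. ?i S (f x) * ?i ?B y" "f x", symmetric]) measurable
  qed
  also have "\<dots> = (\<integral>\<^sup>+y. (\<integral>\<^sup>+x. ?i S (f x) * ?i ?B (f x + y) \<partial>lborel) \<partial>lborel)"
    by (rule lborel_pair.Fubini') simp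
  \<comment> \<open>The substitution turns \<open>f x\<close> into \<open>f x - y\<close>, so
    \<open>y\<close> moves from the ball to \<open>S\<close>. Swapping back separates the volume of
    \<open>S\<close> from that of the preimage of the ball, which is the ball itself because
    \<open>f\<close> preserves norms.\<close>
  also have "\<dots> = (\<integral>\<^sup>+y. (\<integral>\<^sup>+x. ?i S (f (- g y + x)) * ?i ?B (f (- g y + x) + y) \<partial>lborel) \<partial>lborel)"
    by (rule nn_integral_cong, rule transl[symmetric]) simp
  also have "\<dots> = (\<integral>\<^sup>+y. (\<integral>\<^sup>+x. ?i S (f x - y) * ?i ?B (f x) \<partial>lborel) \<partial>lborel)"
  proof -
    have "f (- g y + x) = f x - y" for x y
      using linear_add[OF lin(1), of "- g y" x] linear_neg[OF lin(1), of "g y"] g(3) by simp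
    then show ?thesis by simp
  qed
  also have "\<dots> = (\<integral>\<^sup>+x. (\<integral>\<^sup>+y. ?i S (f x - y) * ?i ?B (f x) \<partial>lborel) \<partial>lborel)"
    by (rule lborel_pair.Fubini') simp
  also have "\<dots> = (\<integral>\<^sup>+x. (\<integral>\<^sup>+y. ?i S y \<partial>lborel) * ?i ?B (f x) \<partial>lborel)"
  proof (rule nn_integral_cong)
    fix x
    have "(\<integral>\<^sup>+y. ?i S (f x - y) \<partial>lborel) = (\<integral>\<^sup>+y. ?i S (f x + y) \<partial>lborel)"
      using refl[of "\<lambda>y. ?i S (f x + y)"] by simp
    then show "(\<integral>\<^sup>+y. ?i S (f x - y) * ?i ?B (f x) \<partial>lborel) = (\<integral>\<^sup>+y. ?i S y \<partial>lborel) * ?i ?B (f x)"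
      by (simp add: nn_integral_multc transl)
  qed
  also have "\<dots> = emeasure lborel S * emeasure lborel ?B"
    using orthogonal_transformation_norm[OF f]
    by (simp add: nn_integral_cmult indicator_def[of ?B] flip: nn_integral_indicator)
  finally have "emeasure ?M S * emeasure lborel ?B = emeasure lborel S * emeasure lborel ?B" .
  moreover have "emeasure lborel ?B \<noteq> 0" "emeasure lborel ?B \<noteq> top"
    using emeasure_lborel_ball_finite[of "0::'a" 1] content_ball_pos[of 1 "0::'a"]
    by (auto simp: measure_def)
  ultimately show "emeasure ?M S = emeasure lborel S"
    by (simp add: ennreal_mult_cancel_left mult.commute[of _ "emeasure lborel ?B"])
qed simp

text \<open>The density depends on \<open>z\<close> only through its norm. Together with the
  invariance of Lebesgue measure this yields the rotation invariance of the standard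
  Gaussian.\<close>

lemma std_normal_density_prod:
  fixes z :: "real ^ 'n"
  shows "(\<Prod>i\<in>UNIV. std_normal_density (z $ i)) = exp (- (norm z)\<^sup>2 / 2) / sqrt (2 * pi) ^ CARD('n)"
proof -
  have "(\<Prod>i\<in>UNIV. std_normal_density (z $ i)) = (\<Prod>i\<in>UNIV. exp (- (z $ i)\<^sup>2 / 2)) / sqrt (2 * pi) ^ CARD('n)"
    by (simp add: std_normal_density_def prod.distrib prod_dividef power_one_over field_simps)
  also have "(\<Prod>i\<in>UNIV. exp (- (z $ i)\<^sup>2 / 2)) = exp (\<Sum>i\<in>UNIV. - (z $ i)\<^sup>2 / 2)"
    by (rule exp_sum[symmetric]) simp
  also have "(\<Sum>i\<in>UNIV. - (z $ i)\<^sup>2 / 2) = - (norm z)\<^sup>2 / 2"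
    by (simp add: norm_vec_def L2_set_def sum_nonneg sum_negf sum_divide_distrib)
  finally show ?thesis .
qed

lemma sets_std_gaussian [simp, measurable_cong]: "sets std_gaussian = sets borel"
  and space_std_gaussian [simp]: "space std_gaussian = UNIV"
  by (simp_all add: std_gaussian_def)

lemma prob_space_std_gaussian: "prob_space (std_gaussian :: (real ^ 'n) measure)"
proof
  have "emeasure std_gaussian (UNIV :: (real ^ 'n) set)
      = (\<integral>\<^sup>+z. (\<Prod>i\<in>UNIV. ennreal (std_normal_density (z $ i))) \<partial>(lborel :: (real ^ 'n) measure))"
    by (simp add: std_gaussian_def emeasure_density prod_ennreal)
  also have "\<dots> = (\<integral>\<^sup>+z. (\<Prod>b\<in>Basis. ennreal (std_normal_density (z \<bullet> b))) \<partial>(lborel :: (real ^ 'n) measure))"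
  proof (rule nn_integral_cong)
    fix z :: "real ^ 'n"
    have "(\<Prod>b\<in>Basis. ennreal (std_normal_density (z \<bullet> b)))
        = (\<Prod>i\<in>UNIV. ennreal (std_normal_density (z \<bullet> axis i 1)))"
      by (rule prod.reindex_cong[of "\<lambda>i. axis i 1"]) (auto simp: inj_on_def axis_eq_axis Basis_vec_def)
    then show "(\<Prod>i\<in>UNIV. ennreal (std_normal_density (z $ i))) = (\<Prod>b\<in>Basis. ennreal (std_normal_density (z \<bullet> b)))"
      by (simp add: inner_axis)
  qed
  also have "\<dots> = (\<Prod>b\<in>(Basis :: (real ^ 'n) set). \<integral>\<^sup>+x. ennreal (std_normal_density x) \<partial>lborel)"
    by (rule nn_integral_lborel_prod) auto
  also have "(\<integral>\<^sup>+x. ennreal (std_normal_density x) \<partial>lborel) = 1"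
    by (simp add: nn_integral_eq_integral)
  finally show "emeasure std_gaussian (space (std_gaussian :: (real ^ 'n) measure)) = 1"
    by simp
qed

lemma null_sets_std_gaussian: "A \<in> null_sets lborel \<Longrightarrow> A \<in> null_sets std_gaussian"
  using absolutely_continuousI_density[of "\<lambda>z. ennreal (\<Prod>i\<in>UNIV. std_normal_density (z $ i))" lborel]
  by (auto simp: std_gaussian_def absolutely_continuous_def)

lemma borel_measurable_matrix_vector_mult [measurable]:
  "(\<lambda>z. (A :: real ^ 'n ^ 'm) *v z) \<in> borel_measurable borel"
  by (intro borel_measurable_continuous_onI matrix_vector_mult_linear_continuous_on)

lemma std_gaussian_distr_orthogonal:
  fixes Q :: "real ^ 'n ^ 'n"
  assumes Q: "orthogonal_matrix Q"
  shows "distr std_gaussian borel ((*v) Q) = std_gaussian"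
proof -
  have ot: "orthogonal_transformation ((*v) Q)"
    using Q by (simp add: orthogonal_transformation_matrix)
  let ?d = "\<lambda>z :: real ^ 'n. ennreal (\<Prod>i\<in>UNIV. std_normal_density (z $ i))"
  have "std_gaussian = density (distr lborel borel ((*v) Q)) ?d"
    by (simp add: lborel_distr_orthogonal[OF ot] std_gaussian_def)
  also have "\<dots> = distr (density lborel (\<lambda>z. ?d (Q *v z))) borel ((*v) Q)"
    by (rule density_distr) auto
  also have "(\<lambda>z. ?d (Q *v z)) = ?d"
    using orthogonal_transformation_norm[OF ot] by (simp add: std_normal_density_prod)
  finally show ?thesis by (simp add: std_gaussian_def)
qed

text \<open>By translation invariance the measure of \<open>Z\<close> is the average over 0 \<le> t
  \<le> 1 of the measures of its translates by \<open>- t *\<^sub>R v\<close>. After Fubini the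
  inner integral runs along a line parallel to \<open>v\<close>, where it meets a finite set. This
  avoids a change of coordinates that would turn \<open>v\<close> into an axis.\<close>

lemma null_sets_if_lines_finite:
  fixes Z :: "'a::euclidean_space set"
  assumes Z [measurable]: "Z \<in> sets borel" and fin: "\<And>y. finite {t::real. y + t *\<^sub>R v \<in> Z}"
  shows "Z \<in> null_sets lborel"
proof -
  let ?i = "indicator :: 'a set \<Rightarrow> 'a \<Rightarrow> ennreal"
  have "emeasure lborel Z = (\<integral>\<^sup>+t. emeasure lborel Z * indicator {0..1} t \<partial>(lborel :: real measure))"
    by (simp add: nn_integral_cmult_indicator)
  also have "\<dots> = (\<integral>\<^sup>+t. (\<integral>\<^sup>+y. ?i Z (y + t *\<^sub>R v) * indicator {0..1} t \<partial>lborel) \<partial>(lborel :: real measure))"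
  proof (rule nn_integral_cong)
    fix t :: real
    have "(\<integral>\<^sup>+y. ?i Z (y + t *\<^sub>R v) \<partial>lborel) = emeasure lborel Z"
      using nn_integral_distr[of "\<lambda>x. t *\<^sub>R v + x" lborel borel "?i Z"]
      unfolding lborel_distr_plus by (simp add: add.commute[of "t *\<^sub>R v"])
    then show "emeasure lborel Z * indicator {0..1} t
        = (\<integral>\<^sup>+y. ?i Z (y + t *\<^sub>R v) * indicator {0..1} t \<partial>lborel)"
      by (simp add: nn_integral_multc)
  qed
  also have "\<dots> = (\<integral>\<^sup>+y. (\<integral>\<^sup>+t. ?i Z (y + t *\<^sub>R v) * indicator {0..1} t \<partial>(lborel :: real measure)) \<partial>lborel)"
    by (rule lborel_pair.Fubini') simp
  also have "\<dots> = (\<integral>\<^sup>+y. 0 \<partial>(lborel :: 'a measure))"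
  proof (rule nn_integral_cong)
    fix y
    have "AE t in (lborel :: real measure). t \<notin> {t. y + t *\<^sub>R v \<in> Z}"
      by (intro AE_not_in countable_imp_null_set_lborel countable_finite fin)
    then have "AE t in (lborel :: real measure). ?i Z (y + t *\<^sub>R v) * indicator {0..1} t = 0"
      by eventually_elim auto
    then show "(\<integral>\<^sup>+t. ?i Z (y + t *\<^sub>R v) * indicator {0..1} t \<partial>(lborel :: real measure)) = 0"
      by (simp add: nn_integral_0_iff_AE)
  qed
  finally show ?thesis by (auto simp: null_sets_def)
qed

lemma finite_real_quadratic_zeros:
  fixes a b c :: real
  assumes "a \<noteq> 0 \<or> b \<noteq> 0"
  shows "finite {t. a * t\<^sup>2 + b * t + c = 0}"
proof -
  have "{t. a * t\<^sup>2 + b * t + c = 0} = {t. poly [:c, b, a:] t = 0}"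
    by (auto simp: algebra_simps power2_eq_square)
  also have "finite \<dots>" by (rule poly_roots_finite) (use assms in auto)
  finally show ?thesis .
qed

lemma null_sets_subspace:
  fixes N :: "'a::euclidean_space set"
  assumes "subspace N" "N \<noteq> UNIV"
  shows "N \<in> null_sets lborel"
proof -
  obtain v where v: "v \<notin> N" using assms by auto
  show ?thesis
  proof (rule null_sets_if_lines_finite[where v = v])
    show "N \<in> sets borel" using closed_subspace[OF assms(1)] by simp
    fix y
    have "s = t" if "y + s *\<^sub>R v \<in> N" "y + t *\<^sub>R v \<in> N" for s t
    proof (rule ccontr)
      assume "s \<noteq> t"
      have "(s - t) *\<^sub>R v \<in> N"
        using subspace_diff[OF assms(1) that] by (simp add: algebra_simps)
      then have "inverse (s - t) *\<^sub>R (s - t) *\<^sub>R v \<in> N"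
        using assms(1) subspace_scale by blast
      with \<open>s \<noteq> t\<close> v show False by simp
    qed
    then have "{t. y + t *\<^sub>R v \<in> N} \<subseteq> {THE t. y + t *\<^sub>R v \<in> N}"
      by (auto intro: the_equality[symmetric])
    then show "finite {t. y + t *\<^sub>R v \<in> N}" by (rule finite_subset) simp
  qed
qed

text \<open>By polarization a symmetric form that vanishes on the diagonal is zero, so some
  \<open>v\<close> has a nonzero value; along lines in that direction the form is a polynomial of
  degree exactly two.\<close>

lemma null_sets_quadratic_form:
  fixes M :: "real ^ 'n ^ 'n"
  assumes "transpose M = M" "M \<noteq> 0"
  shows "{y. y \<bullet> (M *v y) = 0} \<in> null_sets lborel"
proof -
  have sym: "x \<bullet> (M *v y) = y \<bullet> (M *v x)" for x y
    by (metis assms(1) dot_lmul_matrix inner_commute transpose_matrix_vector)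
  have exp: "(y + t *\<^sub>R v) \<bullet> (M *v (y + t *\<^sub>R v))
      = (v \<bullet> (M *v v)) * t\<^sup>2 + (2 * (v \<bullet> (M *v y))) * t + y \<bullet> (M *v y)" for t y v
    using sym[of v y]
    by (simp add: matrix_vector_right_distrib matrix_vector_mult_scaleR inner_left_distrib inner_right_distrib
        power2_eq_square algebra_simps)
  obtain v where v: "v \<bullet> (M *v v) \<noteq> 0"
  proof (rule ccontr)
    assume "\<not> thesis"
    then have z: "v \<bullet> (M *v v) = 0" for v using that by blast
    have "v \<bullet> (M *v y) = 0" for v y
      using exp[of y 1 v] z by simp
    then have "M *v y = 0" for y by (metis inner_eq_zero_iff)
    then have "M = 0" by (metis matrix_eq matrix_vector_mult_0)
    with assms show False by simp
  qed
  show ?thesis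
  proof (rule null_sets_if_lines_finite[where v = v])
    have "closed {y. y \<bullet> (M *v y) = 0}"
      by (intro closed_Collect_eq continuous_intros)
    then show "{y. y \<bullet> (M *v y) = 0} \<in> sets borel" by simp
    show "finite {t. y + t *\<^sub>R v \<in> {y. y \<bullet> (M *v y) = 0}}" for y
      using v by (simp add: exp finite_real_quadratic_zeros)
  qed
qed

text \<open>Serves to discard the points at which the numerator of the test statistic
  vanishes.\<close>

lemma null_sets_affine_equation:
  fixes B :: "real ^ 'n ^ 'm"
  assumes "B \<noteq> 0"
  shows "{y. B *v y = b} \<in> null_sets lborel"
proof -
  obtain v where "B *v v \<noteq> 0"
    using assms by (metis matrix_eq matrix_vector_mult_0)
  then obtain i where i: "(B *v v) $ i \<noteq> 0" by (auto simp: vec_eq_iff)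
  show ?thesis
  proof (rule null_sets_if_lines_finite[where v = v])
    have "closed {y. B *v y = b}"
      by (intro closed_Collect_eq continuous_intros)
    then show "{y. B *v y = b} \<in> sets borel" by simp
    fix y
    have "{t. y + t *\<^sub>R v \<in> {y. B *v y = b}} \<subseteq> {t. 0 * t\<^sup>2 + (B *v v) $ i * t + ((B *v y) $ i - b $ i) = 0}"
      (is "_ \<subseteq> ?S")
      by (auto simp: matrix_vector_right_distrib matrix_vector_mult_scaleR algebra_simps)
    moreover have "finite ?S"
      by (rule finite_real_quadratic_zeros) (use i in simp)
    ultimately show "finite {t. y + t *\<^sub>R v \<in> {y. B *v y = b}}"
      by (rule finite_subset)
  qed
qed

section \<open>Factorization of nonnegative definite matrices\<close>

lemma transpose_plus: "transpose (A + B) = transpose A + transpose (B :: 'a::plus ^ 'n ^ 'm)"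
  and transpose_minus: "transpose (C - D) = transpose C - transpose (D :: 'b::minus ^ 'n ^ 'm)"
  by (simp_all add: transpose_def vec_eq_iff)

lemma inner_matrix_vector_mult: "x \<bullet> (A *v y) = (transpose A *v x) \<bullet> (y :: real ^ 'n)"
  by (simp add: dot_lmul_matrix transpose_matrix_vector)

definition pos_def :: "real ^ 'n ^ 'n \<Rightarrow> bool" where
  "pos_def S \<longleftrightarrow> transpose S = S \<and> (\<forall>x. x \<noteq> 0 \<longrightarrow> 0 < x \<bullet> (S *v x))"

text \<open>Gram-Schmidt for the inner product \<open>x \<bullet> (S *v y)\<close> gives a basis,
  the columns of \<open>V\<close>, with V' S V = 1. Then V V' S = 1 as well, and A = S V satisfies A
  A' = S V V' S = S. This guarantees that the choice in \<open>gaussian\<close> picks an actual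
  factor.\<close>

lemma pos_def_eq_mult_transpose:
  fixes S :: "real ^ 'n ^ 'n"
  assumes "pos_def S"
  shows "\<exists>A :: real ^ 'n ^ 'n. A ** transpose A = S"
proof -
  have sym: "transpose S = S" and pos: "\<And>x. x \<noteq> 0 \<Longrightarrow> 0 < x \<bullet> (S *v x)"
    using assms by (auto simp: pos_def_def)
  have comm: "x \<bullet> (S *v y) = y \<bullet> (S *v x)" for x y
    by (metis sym dot_lmul_matrix inner_commute transpose_matrix_vector)
  have "\<exists>B :: (real ^ 'n) set. finite B \<and> card B = m \<and> (\<forall>x\<in>B. \<forall>y\<in>B. x \<bullet> (S *v y) = (if x = y then 1 else 0))"
    if "m \<le> CARD('n)" for m
    using that
  proof (induction m)
    case 0
    show ?case by (rule exI[of _ "{}"]) simp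
  next
    case (Suc m)
    then obtain B :: "(real ^ 'n) set" where B: "finite B" "card B = m"
      "\<And>x y. x \<in> B \<Longrightarrow> y \<in> B \<Longrightarrow> x \<bullet> (S *v y) = (if x = y then 1 else 0)"
      by auto
    have "dim (span B) < DIM(real ^ 'n)"
      using dim_le_card'[OF B(1)] B(2) Suc.prems by simp
    then obtain x where x: "x \<notin> span B"
      by (metis UNIV_I dim_UNIV nat_neq_iff subsetI subset_antisym top_greatest)
    define y where "y = x - (\<Sum>b\<in>B. (b \<bullet> (S *v x)) *\<^sub>R b)"
    have "y \<noteq> 0"
      using x span_sum[of B "\<lambda>b. (b \<bullet> (S *v x)) *\<^sub>R b" B] by (auto simp: y_def span_scale span_base)
    then have y: "0 < y \<bullet> (S *v y)" by (rule pos)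
    have orth: "b \<bullet> (S *v y) = 0" if "b \<in> B" for b
    proof -
      have "b \<bullet> (S *v y) = b \<bullet> (S *v x) - (\<Sum>b'\<in>B. (b' \<bullet> (S *v x)) * (b \<bullet> (S *v b')))"
        by (simp add: y_def matrix_vector_mult_diff_distrib inner_diff_right
            linear_sum[OF matrix_vector_mul_linear] inner_sum_right matrix_vector_mult_scaleR)
      also have "(\<Sum>b'\<in>B. (b' \<bullet> (S *v x)) * (b \<bullet> (S *v b'))) = (\<Sum>b'\<in>B. if b = b' then b' \<bullet> (S *v x) else 0)"
        using that B(3) by (intro sum.cong) auto
      finally show ?thesis using that B(1) by simp
    qed
    define u where "u = (1 / sqrt (y \<bullet> (S *v y))) *\<^sub>R y"
    have u: "u \<bullet> (S *v u) = 1"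
      using y by (simp add: u_def matrix_vector_mult_scaleR real_sqrt_mult_self)
    have orth: "b \<bullet> (S *v u) = 0" "u \<bullet> (S *v b) = 0" if "b \<in> B" for b
      using orth[OF that] comm[of u b] by (simp_all add: u_def matrix_vector_mult_scaleR)
    then have "u \<notin> B" using u by force
    show ?case
      using B u orth \<open>u \<notin> B\<close> by (intro exI[of _ "insert u B"]) auto
  qed
  from this[OF order_refl] obtain B :: "(real ^ 'n) set" where B: "finite B" "card B = CARD('n)"
      "\<And>x y. x \<in> B \<Longrightarrow> y \<in> B \<Longrightarrow> x \<bullet> (S *v y) = (if x = y then 1 else 0)"
    by auto
  obtain h where h: "bij_betw h (UNIV :: 'n set) B"
    using finite_same_card_bij[of "UNIV :: 'n set" B] B by auto
  define V :: "real ^ 'n ^ 'n" where "V = (\<chi> i j. h j $ i)"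
  have "(transpose V ** (S ** V)) $ i $ j = (mat 1 :: real ^ 'n ^ 'n) $ i $ j" for i j
  proof -
    have "(transpose V ** (S ** V)) $ i $ j = h i \<bullet> (S *v h j)"
      by (simp add: V_def matrix_matrix_mult_def transpose_def matrix_vector_mult_def inner_vec_def)
    also have "\<dots> = (if h i = h j then 1 else 0)"
      using h by (intro B(3)) (auto simp: bij_betw_def)
    finally show ?thesis
      using h by (simp add: mat_def bij_betw_def inj_eq)
  qed
  then have "(transpose V ** S) ** V = mat 1" by (simp add: vec_eq_iff matrix_mul_assoc)
  then have "V ** (transpose V ** S) = mat 1" by (simp add: matrix_left_right_inverse)
  then have "S ** V ** transpose (S ** V) = S"
    by (simp add: matrix_transpose_mul sym) (metis matrix_mul_assoc matrix_mul_rid)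
  then show ?thesis by blast
qed

lemma orthogonal_matrix_iff: "orthogonal_matrix Q \<longleftrightarrow> (\<forall>x. norm (Q *v x) = norm (x :: real ^ 'n))"
  by (metis matrix_of_matrix_vector_mul matrix_vector_mul_linear orthogonal_transformation orthogonal_transformation_matrix)

text \<open>A' vanishes on the kernel \<open>K\<close> of P and is isometric on the range of P.
  Hence the range of A' has the dimension of the range of P, the complements \<open>K\<close> and
  \<open>L\<close> have equal dimensions, and some linear isometry \<open>f\<close> takes
  \<open>K\<close> onto \<open>L\<close>. Gluing A' on the range of P to \<open>f\<close> on
  \<open>K\<close> gives the orthogonal matrix Q'; the part added to A is removed again by P because
  P E = 0.\<close>

lemma projection_eq_mult_orthogonal:
  fixes P A :: "real ^ 'n ^ 'n"
  assumes P: "transpose P = P" "P ** P = P" and A: "A ** transpose A = P"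
  shows "\<exists>Q. orthogonal_matrix Q \<and> A = P ** Q"
proof -
  have normA: "(norm (transpose A *v x))\<^sup>2 = x \<bullet> (P *v x)" for x
  proof -
    have "(norm (transpose A *v x))\<^sup>2 = x \<bullet> (A *v (transpose A *v x))"
      by (metis dot_lmul_matrix dot_square_norm transpose_matrix_vector)
    then show ?thesis by (simp add: matrix_vector_mul_assoc A)
  qed
  have PP: "P *v (P *v x) = P *v x" for x by (simp add: matrix_vector_mul_assoc P)
  have Psym: "x \<bullet> (P *v y) = (P *v x) \<bullet> y" for x y
    by (metis P(1) dot_lmul_matrix transpose_matrix_vector)
  define E where "E = mat 1 - P"
  have E: "E *v x = x - P *v x" for x by (simp add: E_def matrix_vector_mult_diff_rdistrib)
  have AE: "transpose A *v (E *v x) = 0" for x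
    using normA[of "E *v x"] by (simp add: E matrix_vector_mult_diff_distrib PP)
  then have AP: "transpose A *v (P *v x) = transpose A *v x" for x
    using AE[of x] by (simp add: E matrix_vector_mult_diff_distrib)
  define K where "K = range ((*v) E)"
  define L where "L = (range ((*v) (transpose A)))\<^sup>\<bottom>"
  have sub: "subspace K" "subspace (range ((*v) P))" "subspace (range ((*v) (transpose A)))"
    by (auto simp: K_def intro!: linear_subspace_image)
  have dimP: "dim (range ((*v) (transpose A))) = dim (range ((*v) P))"
  proof -
    have "range ((*v) (transpose A)) = (*v) (transpose A) ` range ((*v) P)"
      using AP by (auto simp: image_iff)
    moreover have "dim ((*v) (transpose A) ` range ((*v) P)) = dim (range ((*v) P))"
    proof (rule dim_image_eq)
      show "inj_on ((*v) (transpose A)) (span (range ((*v) P)))"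
      proof (rule inj_onI)
        fix x y assume xy: "x \<in> span (range ((*v) P))" "y \<in> span (range ((*v) P))" "transpose A *v x = transpose A *v y"
        then have fx: "P *v x = x" "P *v y = y"
          using sub(2) PP by (auto simp: span_eq_iff[THEN iffD2])
        have "(x - y) \<bullet> (P *v (x - y)) = 0"
          using normA[of "x - y"] xy(3) by (simp add: matrix_vector_mult_diff_distrib)
        then show "x = y" using fx by (simp add: matrix_vector_mult_diff_distrib)
      qed
    qed simp
    ultimately show ?thesis by simp
  qed
  have "K = (range ((*v) P))\<^sup>\<bottom>"
  proof (intro set_eqI iffI)
    fix x assume "x \<in> K"
    then show "x \<in> (range ((*v) P))\<^sup>\<bottom>"
      by (auto simp: K_def orthogonal_comp_def orthogonal_def E inner_diff_right Psym PP)
  next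
    fix x assume "x \<in> (range ((*v) P))\<^sup>\<bottom>"
    then have "(P *v x) \<bullet> (P *v x) = 0"
      using Psym[of "P *v x" x] by (auto simp: orthogonal_comp_def orthogonal_def PP)
    then have "x = E *v x" by (simp add: E)
    then show "x \<in> K" unfolding K_def by blast
  qed
  then have "dim K = dim L"
    using dim_subspace_orthogonal_to_vectors[of "range ((*v) P)" UNIV]
      dim_subspace_orthogonal_to_vectors[of "range ((*v) (transpose A))" UNIV] sub dimP
    by (simp add: L_def orthogonal_comp_def orthogonal_commute)
  then obtain f g where f: "linear f" "f ` K = L" "\<And>x. x \<in> K \<Longrightarrow> norm (f x) = norm x"
    using isometries_subspaces[of K L] sub subspace_orthogonal_comp unfolding L_def by metis
  define F where "F = matrix f"
  have F: "F *v x = f x" for x by (simp add: F_def f(1) matrix_works)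
  define Q where "Q = A + E ** transpose F"
  have Qt: "transpose Q *v x = transpose A *v x + f (E *v x)" for x
    by (simp add: Q_def transpose_plus matrix_transpose_mul matrix_vector_mult_add_rdistrib P(1) E_def
        transpose_minus transpose_mat F flip: matrix_vector_mul_assoc)
  have "norm (transpose Q *v x) = norm x" for x
  proof -
    have "E *v x \<in> K" by (simp add: K_def)
    then have "f (E *v x) \<in> L" "norm (f (E *v x)) = norm (E *v x)" using f by auto
    then have "orthogonal (transpose A *v x) (f (E *v x))"
      by (auto simp: L_def orthogonal_comp_def)
    then have "(norm (transpose Q *v x))\<^sup>2 = x \<bullet> (P *v x) + (norm (E *v x))\<^sup>2"
      by (simp add: Qt norm_add_Pythagorean normA \<open>norm (f (E *v x)) = _\<close>)
    also have "\<dots> = (norm x)\<^sup>2"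
      using Psym[of x "P *v x"] inner_commute[of "P *v x" x]
      by (simp add: E power2_norm_eq_inner inner_diff_left inner_diff_right PP)
    finally show ?thesis by simp
  qed
  then have "orthogonal_matrix (transpose Q)"
    by (simp add: orthogonal_transformation orthogonal_matrix_iff)
  then have Q: "orthogonal_matrix Q" by simp
  have PA: "transpose A ** P = transpose A"
    by (simp add: matrix_eq AP flip: matrix_vector_mul_assoc)
  have "P ** A = A" using arg_cong[OF PA, of transpose] by (simp add: matrix_transpose_mul P)
  moreover have "P ** E = 0"
    by (simp add: matrix_eq E PP matrix_vector_mult_diff_distrib flip: matrix_vector_mul_assoc)
  ultimately have "A = P ** Q"
    by (simp add: Q_def matrix_add_ldistrib matrix_mul_assoc)
  with Q show ?thesis by blast
qed

section \<open>Autoregressive spectral densities near a point mass\<close>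

lemma cos_diff_le: "\<bar>cos x - cos y\<bar> \<le> \<bar>x - y\<bar>" for x y :: real
proof -
  have "\<bar>cos x - cos y\<bar> = 2 * (\<bar>sin ((x + y) / 2)\<bar> * \<bar>sin ((y - x) / 2)\<bar>)"
    by (simp add: cos_diff_cos abs_mult)
  also have "\<dots> \<le> 2 * (1 * \<bar>(y - x) / 2\<bar>)"
    by (intro mult_left_mono mult_mono abs_sin_x_le_abs_x) auto
  finally show ?thesis by simp
qed

text \<open>With both roots on the unit circle the polynomial is
  \<open>z * (z + cnj z - 2 * cos \<theta>)\<close> for \<open>cmod z = 1\<close>, whose modulus is
  exactly the subtracted term. The two coefficients change by at most
  \<open>2 * (1 - \<rho>)\<close> each when \<rho> replaces 1.\<close>

lemma ar2_poly_norm: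
  fixes \<rho> \<theta> \<omega> :: real
  assumes "0 \<le> \<rho>" "\<rho> \<le> 1"
  shows "\<bar>cmod (1 - of_real (2 * \<rho> * cos \<theta>) * exp (- \<i> * of_real \<omega>) - of_real (- \<rho>\<^sup>2) * exp (- 2 * \<i> * of_real \<omega>))
      - 2 * \<bar>cos \<omega> - cos \<theta>\<bar>\<bar> \<le> 4 * (1 - \<rho>)"
proof -
  define z where "z = exp (- \<i> * of_real \<omega>)"
  have z2: "exp (- 2 * \<i> * of_real \<omega>) = z\<^sup>2"
    by (simp add: z_def mult.assoc flip: exp_double)
  have nz: "cmod z = 1" by (simp add: z_def norm_exp_eq_Re)
  define \<phi> where "\<phi> = 1 - of_real (2 * \<rho> * cos \<theta>) * z - of_real (- \<rho>\<^sup>2) * z\<^sup>2"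
  define \<psi> where "\<psi> = 1 - of_real (2 * cos \<theta>) * z + z\<^sup>2"
  have zz: "z * cnj z = 1" using nz by (simp add: complex_norm_square[symmetric])
  have re: "z + cnj z = of_real (2 * cos \<omega>)"
    by (simp add: complex_add_cnj z_def Re_exp)
  have "\<psi> = z * (z + cnj z) - of_real (2 * cos \<theta>) * z"
    by (simp add: \<psi>_def algebra_simps zz power2_eq_square)
  also have "\<dots> = z * of_real (2 * (cos \<omega> - cos \<theta>))"
    by (simp add: re algebra_simps)
  finally have \<psi>: "cmod \<psi> = 2 * \<bar>cos \<omega> - cos \<theta>\<bar>"
    by (simp only: norm_mult nz norm_of_real abs_mult abs_numeral mult.left_neutral)
  have "cmod (\<phi> - \<psi>) = cmod (of_real (2 * (1 - \<rho>) * cos \<theta>) * z - of_real (1 - \<rho>\<^sup>2) * z\<^sup>2)"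
    by (rule arg_cong[where f = cmod]) (simp add: \<phi>_def \<psi>_def algebra_simps)
  also have "\<dots> \<le> cmod (of_real (2 * (1 - \<rho>) * cos \<theta>) * z) + cmod (of_real (1 - \<rho>\<^sup>2) * z\<^sup>2)"
    by (rule norm_triangle_ineq4)
  also have "\<dots> = \<bar>2 * (1 - \<rho>) * cos \<theta>\<bar> + \<bar>1 - \<rho>\<^sup>2\<bar>"
    by (simp only: norm_mult norm_of_real norm_power nz) simp
  also have "\<bar>2 * (1 - \<rho>) * cos \<theta>\<bar> \<le> 2 * (1 - \<rho>)"
    using assms by (simp add: abs_mult mult_left_le)
  also have "\<bar>1 - \<rho>\<^sup>2\<bar> \<le> 2 * (1 - \<rho>)"
  proof -
    have "1 - \<rho>\<^sup>2 = (1 + \<rho>) * (1 - \<rho>)" by (simp add: power2_eq_square algebra_simps)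
    moreover have "0 \<le> (1 + \<rho>) * (1 - \<rho>)" using assms by simp
    moreover have "(1 + \<rho>) * (1 - \<rho>) \<le> 2 * (1 - \<rho>)"
      by (rule mult_right_mono) (use assms in auto)
    ultimately show ?thesis by simp
  qed
  finally have "\<bar>cmod \<phi> - cmod \<psi>\<bar> \<le> 4 * (1 - \<rho>)"
    using norm_triangle_ineq3[of \<phi> \<psi>] by simp
  then show ?thesis unfolding z2 z_def[symmetric] \<psi> \<phi>_def .
qed

text \<open>Each factor \<open>1 - \<rho> * cis (\<plusminus>\<theta>) * z\<close> could vanish only
  at modulus 1 / \<rho>, outside the closed disc.\<close>

lemma ar2_poly_nonzero:
  fixes z :: complex
  assumes "0 \<le> \<rho>" "\<rho> < 1" "cmod z \<le> 1"
  shows "1 - of_real (2 * \<rho> * cos \<theta>) * z - of_real (- \<rho>\<^sup>2) * z\<^sup>2 \<noteq> 0"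
proof -
  have "1 - of_real (2 * \<rho> * cos \<theta>) * z - of_real (- \<rho>\<^sup>2) * z\<^sup>2
      = (1 - of_real \<rho> * cis \<theta> * z) * (1 - of_real \<rho> * cis (- \<theta>) * z)"
  proof -
    have "cis \<theta> + cis (- \<theta>) = of_real (2 * cos \<theta>)" "cis \<theta> * cis (- \<theta>) = 1"
      by (simp_all add: complex_eq_iff cis_mult)
    moreover have "(1 - of_real \<rho> * a * z) * (1 - of_real \<rho> * b * z)
        = 1 - of_real \<rho> * (a + b) * z + of_real (\<rho>\<^sup>2) * (a * b) * z\<^sup>2" for a b :: complex
      by (simp add: power2_eq_square algebra_simps)
    ultimately show ?thesis by simp
  qed
  moreover have "1 - of_real \<rho> * cis t * z \<noteq> 0" for t
  proof
    assume "1 - of_real \<rho> * cis t * z = 0"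
    then have "cmod (of_real \<rho> * cis t * z) = 1" by (metis eq_iff_diff_eq_0 norm_one)
    then have "\<rho> * cmod z = 1" using assms(1) by (simp add: norm_mult)
    with assms show False
      by (metis less_le_not_le mult_left_le mult.commute order_trans)
  qed
  ultimately show ?thesis by simp
qed

text \<open>The numbers \<open>cos (h \<theta>)\<close> satisfy the same recursion with \<open>\<eta> = 0\<close>; this replaces an argument by
  weak convergence of the spectral measures.\<close>

lemma cos_moment_recursion:
  fixes \<gamma> :: "nat \<Rightarrow> real"
  assumes "\<gamma> 0 = 1" "\<bar>\<gamma> 1 - cos \<theta>\<bar> \<le> \<eta>"
    and "\<And>h. \<bar>\<gamma> (h + 2) - 2 * cos \<theta> * \<gamma> (h + 1) + \<gamma> h\<bar> \<le> 2 * \<eta>"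
  shows "\<bar>\<gamma> h - cos (real h * \<theta>)\<bar> \<le> 4 ^ h * \<eta>"
proof -
  have "0 \<le> \<eta>" using assms(2) by linarith
  define e where "e h = \<gamma> h - cos (real h * \<theta>)" for h
  have step: "\<bar>e (h + 2)\<bar> \<le> 2 * \<bar>e (h + 1)\<bar> + \<bar>e h\<bar> + 2 * \<eta>" for h
  proof -
    have "cos (real (h + 2) * \<theta>) + cos (real h * \<theta>) = 2 * cos \<theta> * cos (real (h + 1) * \<theta>)"
      using cos_plus_cos[of "real (h + 2) * \<theta>" "real h * \<theta>"] by (simp add: algebra_simps add_divide_distrib)
    then have "e (h + 2) = 2 * (cos \<theta> * e (h + 1)) - e h + (\<gamma> (h + 2) - 2 * cos \<theta> * \<gamma> (h + 1) + \<gamma> h)"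
      by (simp add: e_def algebra_simps)
    moreover have "\<bar>cos \<theta> * e (h + 1)\<bar> \<le> \<bar>e (h + 1)\<bar>"
      by (simp add: abs_mult mult_left_le_one_le)
    ultimately show ?thesis using assms(3)[of h] by linarith
  qed
  \<comment> \<open>The recursion is of second order, so two consecutive errors are carried along.
    As \<open>\<eta> \<le> 4 ^ h * \<eta>\<close>, the step amounts to 8 + 1 + 2 \<le> 16, for which
    the crude base 4 suffices.\<close>
  have "\<bar>e h\<bar> \<le> 4 ^ h * \<eta> \<and> \<bar>e (h + 1)\<bar> \<le> 4 ^ (h + 1) * \<eta>"
  proof (induction h)
    case 0
    show ?case using assms(1,2) \<open>0 \<le> \<eta>\<close> by (simp add: e_def)
  next
    case (Suc h)
    have "\<eta> \<le> 4 ^ h * \<eta>" using \<open>0 \<le> \<eta>\<close> by (simp add: mult_le_cancel_right1)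
    with Suc step[of h] show ?case by (simp del: abs_le_iff) linarith
  qed
  then show ?thesis by (simp add: e_def)
qed

text \<open>Only the cosine moments of lags below n enter an n-dimensional covariance matrix, so
  finitely many of them have to be matched. Concentration at \<plusminus>\<theta> is measured by the
  mean \<eta> of \<open>\<bar>cos \<omega> - cos \<theta>\<bar>\<close>, which bounds the error in
  the recursion of the moments.\<close>

lemma ex_F_AR2_near_point_mass:
  fixes \<theta> \<delta> :: real
  assumes \<theta>: "0 < \<theta>" "\<theta> \<le> 1" and \<delta>: "0 < \<delta>"
  obtains f where "f \<in> F_AR2" "continuous_on {-pi..pi} f"
    "\<And>h. h < n \<Longrightarrow> \<bar>integral {-pi..pi} (\<lambda>\<omega>. cos (real h * \<omega>) * f \<omega>) - cos (real h * \<theta>)\<bar> \<le> \<delta>"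
proof -
  \<comment> \<open>\<open>s\<close> is the weight in the AM-GM step below, and
    \<open>\<epsilon> = s\<^sup>2\<close> is the distance of the inverse roots from the unit circle,
    so that \<epsilon> / s is again s. The factor \<open>4 ^ n\<close> pays for the recursion; 200
    covers half of 3 + 288, the total left by the estimate of 2 \<eta>.\<close>
  define s where "s = min (1 / 2) (\<delta> / (200 * 4 ^ n))"
  define \<epsilon> where "\<epsilon> = s\<^sup>2"
  have s: "0 < s" "s \<le> 1 / 2" "200 * 4 ^ n * s \<le> \<delta>"
    using \<delta> by (auto simp: s_def min_def field_simps)
  have \<epsilon>: "0 < \<epsilon>" "\<epsilon> \<le> s / 2"
    using s mult_left_mono[of s "1/2" s] by (auto simp: \<epsilon>_def power2_eq_square)
  then have "\<epsilon> < 1" using s by simp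
  note \<epsilon> = \<epsilon> this
  define \<phi> where "\<phi> \<omega> = 1 - of_real (2 * (1 - \<epsilon>) * cos \<theta>) * exp (- \<i> * of_real \<omega>)
      - of_real (- (1 - \<epsilon>)\<^sup>2) * exp (- 2 * \<i> * of_real \<omega>)" for \<omega> :: real
  have \<phi>_near: "\<bar>cmod (\<phi> \<omega>) - 2 * \<bar>cos \<omega> - cos \<theta>\<bar>\<bar> \<le> 4 * \<epsilon>" for \<omega>
    using ar2_poly_norm[of "1 - \<epsilon>" \<theta> \<omega>] \<epsilon> by (simp add: \<phi>_def)
  have \<phi>_nz: "\<phi> \<omega> \<noteq> 0" for \<omega>
  proof -
    have "exp (- 2 * \<i> * of_real \<omega>) = (exp (- \<i> * of_real \<omega>))\<^sup>2"
      by (simp add: mult.assoc flip: exp_double)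
    then show ?thesis
      using ar2_poly_nonzero[of "1 - \<epsilon>" "exp (- \<i> * of_real \<omega>)" \<theta>] \<epsilon>
      by (simp add: \<phi>_def norm_exp_eq_Re)
  qed
  have \<phi>_minus: "cmod (\<phi> (- \<omega>)) = cmod (\<phi> \<omega>)" for \<omega>
  proof -
    have "\<phi> (- \<omega>) = cnj (\<phi> \<omega>)" by (simp add: \<phi>_def exp_cnj)
    then show ?thesis by simp
  qed
  have [continuous_intros]: "continuous_on S (\<lambda>\<omega>. cmod (\<phi> \<omega>))" for S
    unfolding \<phi>_def by (intro continuous_intros)
  have int: "g integrable_on {-pi..pi}" if "continuous_on {-pi..pi} g" for g :: "real \<Rightarrow> real"
    using that by (rule integrable_continuous_interval)
  define D where "D \<omega> = (cmod (\<phi> \<omega>))\<^sup>2" for \<omega>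
  have D: "0 < D \<omega>" for \<omega> using \<phi>_nz by (simp add: D_def)
  have contD [continuous_intros]: "continuous_on S D" for S
    unfolding D_def by (intro continuous_intros)
  define c where "c = integral {-pi..pi} (\<lambda>\<omega>. 1 / D \<omega>)"
  have Dint: "(\<lambda>\<omega>. 1 / D \<omega>) integrable_on {a..b}" for a b
    using D by (intro integrable_continuous_interval continuous_intros) (auto simp: less_le)
  \<comment> \<open>On the window of length \<epsilon> to the right of \<theta> the modulus of
    \<phi> is at most 2 \<epsilon> + 4 \<epsilon>, hence the integrand is at least
    \<open>1 / (36 * \<epsilon>\<^sup>2)\<close> there.\<close>
  have c: "1 / (36 * \<epsilon>) \<le> c"
  proof -
    have "1 / (36 * \<epsilon>) = integral {\<theta>..\<theta> + \<epsilon>} (\<lambda>\<omega>. 1 / (36 * \<epsilon>\<^sup>2))"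
      using \<epsilon> by (simp add: power2_eq_square)
    also have "\<dots> \<le> integral {\<theta>..\<theta> + \<epsilon>} (\<lambda>\<omega>. 1 / D \<omega>)"
    proof (rule integral_le)
      fix \<omega> assume "\<omega> \<in> {\<theta>..\<theta> + \<epsilon>}"
      then have "\<bar>\<omega> - \<theta>\<bar> \<le> \<epsilon>" by auto
      then have "cmod (\<phi> \<omega>) \<le> 6 * \<epsilon>"
        using cos_diff_le[of \<omega> \<theta>] \<phi>_near[of \<omega>] by argo
      then have "D \<omega> \<le> (6 * \<epsilon>)\<^sup>2" unfolding D_def by (rule power_mono) simp
      then show "1 / (36 * \<epsilon>\<^sup>2) \<le> 1 / D \<omega>"
        using D[of \<omega>] by (intro divide_left_mono) (auto simp: power_mult_distrib zero_less_mult_iff)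
    qed (auto intro: Dint)
    also have "\<dots> \<le> c"
      unfolding c_def
      using \<theta> \<epsilon> pi_gt3 D by (intro integral_subset_le Dint) (auto simp: less_imp_le)
    finally show ?thesis .
  qed
  have c0: "0 < c" using c \<epsilon> by (smt (verit) divide_pos_pos)
  have c_inv: "1 / c \<le> 36 * \<epsilon>" using c c0 \<epsilon> by (simp add: field_simps)
  define v where "v = 2 * pi / c"
  define f where "f = ar2_density v (2 * (1 - \<epsilon>) * cos \<theta>) (- (1 - \<epsilon>)\<^sup>2)"
  have f: "f \<omega> = 1 / c / D \<omega>" if "\<omega> \<in> {-pi..pi}" for \<omega>
    using that by (simp add: f_def ar2_density_def v_def D_def \<phi>_def)
  have cont: "continuous_on {-pi..pi} f"
  proof (rule continuous_on_eq)
    show "continuous_on {-pi..pi} (\<lambda>\<omega>. 1 / c / D \<omega>)"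
      using c0 D by (intro continuous_intros) (auto simp: less_le)
  qed (use f in auto)
  note cont[continuous_intros]
  have f0: "0 \<le> f \<omega>" for \<omega> using c0 by (simp add: f_def ar2_density_def v_def)
  have f1: "integral {-pi..pi} f = 1"
  proof -
    have "integral {-pi..pi} f = integral {-pi..pi} (\<lambda>\<omega>. 1 / c * (1 / D \<omega>))"
      by (intro integral_cong) (use f in auto)
    also have "\<dots> = 1" unfolding integral_mult_right c_def[symmetric] using c0 by simp
    finally show ?thesis .
  qed
  have fD: "integral {-pi..pi} (\<lambda>\<omega>. D \<omega> * f \<omega>) \<le> 72 * pi * \<epsilon>"
  proof -
    have "integral {-pi..pi} (\<lambda>\<omega>. D \<omega> * f \<omega>) = integral {-pi..pi} (\<lambda>\<omega>. 1 / c)"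
      by (intro integral_cong) (use f D in \<open>auto simp: less_le\<close>)
    also have "\<dots> = 2 * pi * (1 / c)" by simp
    also have "\<dots> \<le> 2 * pi * (36 * \<epsilon>)" by (intro mult_left_mono c_inv) auto
    finally show ?thesis by simp
  qed
  define \<eta> where "\<eta> = integral {-pi..pi} (\<lambda>\<omega>. \<bar>cos \<omega> - cos \<theta>\<bar> * f \<omega>)"
  (* D * f is constant, and its value is small because the integral of 1 / D is large; AM-GM passes
     from D, the square of the AR polynomial, to its modulus *)
  have "2 * \<eta> \<le> integral {-pi..pi} (\<lambda>\<omega>. (s + 4 * \<epsilon>) * f \<omega> + 1 / s * (D \<omega> * f \<omega>))"
    unfolding \<eta>_def integral_mult_right[symmetric]
  proof (rule integral_le)
    fix \<omega> :: real
    have "cmod (\<phi> \<omega>) \<le> s + 1 / s * D \<omega>"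
    proof -
      have "0 \<le> (cmod (\<phi> \<omega>) - s)\<^sup>2 + s * cmod (\<phi> \<omega>)" using s by simp
      then have "s * cmod (\<phi> \<omega>) \<le> s * s + D \<omega>" by (simp add: D_def power2_eq_square algebra_simps)
      then show ?thesis using s by (simp add: field_simps)
    qed
    then have "2 * \<bar>cos \<omega> - cos \<theta>\<bar> \<le> s + 4 * \<epsilon> + 1 / s * D \<omega>"
      using \<phi>_near[of \<omega>] by linarith
    from mult_right_mono[OF this f0[of \<omega>]]
    show "2 * (\<bar>cos \<omega> - cos \<theta>\<bar> * f \<omega>) \<le> (s + 4 * \<epsilon>) * f \<omega> + 1 / s * (D \<omega> * f \<omega>)"
      by (simp add: algebra_simps)
  qed (use s in \<open>auto intro!: int continuous_intros\<close>)
  also have "\<dots> = (s + 4 * \<epsilon>) * integral {-pi..pi} f + 1 / s * integral {-pi..pi} (\<lambda>\<omega>. D \<omega> * f \<omega>)"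
    unfolding integral_mult_right[symmetric]
    by (rule integral_add) (use s in \<open>auto intro!: int continuous_intros\<close>)
  also have "\<dots> \<le> (s + 4 * \<epsilon>) + 1 / s * (72 * pi * \<epsilon>)"
    unfolding f1 using s by (intro add_mono mult_left_mono fD) auto
  also have "1 / s * (72 * pi * \<epsilon>) = 72 * pi * s" using s by (simp add: \<epsilon>_def power2_eq_square)
  also have "72 * pi * s \<le> 72 * 4 * s" using s pi_less_4 by simp
  finally have "\<eta> \<le> 200 * s" using \<epsilon> s by simp
  define \<gamma> where "\<gamma> h = integral {-pi..pi} (\<lambda>\<omega>. cos (real h * \<omega>) * f \<omega>)" for h
  have le_\<eta>: "\<bar>integral {-pi..pi} (\<lambda>\<omega>. g \<omega> * (cos \<omega> - cos \<theta>) * f \<omega>)\<bar> \<le> K * \<eta>"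
    if g: "continuous_on {-pi..pi} g" "\<And>\<omega>. \<bar>g \<omega>\<bar> \<le> K" for g K
    unfolding \<eta>_def integral_mult_right[symmetric] real_norm_def[symmetric]
  proof (rule integral_norm_bound_integral)
    fix \<omega>
    have "\<bar>g \<omega>\<bar> * (\<bar>cos \<omega> - cos \<theta>\<bar> * f \<omega>) \<le> K * (\<bar>cos \<omega> - cos \<theta>\<bar> * f \<omega>)"
      using g f0 by (intro mult_right_mono) auto
    then show "norm (g \<omega> * (cos \<omega> - cos \<theta>) * f \<omega>) \<le> K * (norm (cos \<omega> - cos \<theta>) * f \<omega>)"
      using f0 by (simp add: abs_mult mult.assoc)
  qed (use g in \<open>auto intro!: int continuous_intros\<close>)
  have "\<bar>\<gamma> h - cos (real h * \<theta>)\<bar> \<le> 4 ^ h * \<eta>" for h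
  proof (rule cos_moment_recursion)
    show "\<gamma> 0 = 1" using f1 by (simp add: \<gamma>_def)
    have "\<gamma> 1 - cos \<theta> = integral {-pi..pi} (\<lambda>\<omega>. cos \<omega> * f \<omega>) - integral {-pi..pi} (\<lambda>\<omega>. cos \<theta> * f \<omega>)"
      using f1 by (simp add: \<gamma>_def)
    also have "\<dots> = integral {-pi..pi} (\<lambda>\<omega>. cos \<omega> * f \<omega> - cos \<theta> * f \<omega>)"
      by (rule integral_diff[symmetric]) (auto intro!: int continuous_intros)
    finally have "\<gamma> 1 - cos \<theta> = integral {-pi..pi} (\<lambda>\<omega>. 1 * (cos \<omega> - cos \<theta>) * f \<omega>)"
      by (simp add: algebra_simps)
    then show "\<bar>\<gamma> 1 - cos \<theta>\<bar> \<le> \<eta>" using le_\<eta>[of "\<lambda>_. 1" 1] by simp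
    fix h
    let ?c = "\<lambda>h \<omega>. cos (real h * \<omega>) * f \<omega>"
    have i: "?c h integrable_on {-pi..pi}" for h by (auto intro!: int continuous_intros)
    have i2: "(\<lambda>\<omega>. (2 * cos \<theta>) * ?c (h + 1) \<omega>) integrable_on {-pi..pi}"
      by (auto intro!: int continuous_intros)
    have "\<gamma> (h + 2) - 2 * cos \<theta> * \<gamma> (h + 1) + \<gamma> h
        = integral {-pi..pi} (\<lambda>\<omega>. ?c (h + 2) \<omega> - (2 * cos \<theta>) * ?c (h + 1) \<omega> + ?c h \<omega>)"
      unfolding \<gamma>_def integral_mult_right[symmetric]
      by (subst integral_add[OF integrable_diff[OF i i2] i]) (simp only: integral_diff[OF i i2])
    \<comment> \<open>The sum-to-product formula turns the error of the recursion into an integral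
      of \<open>cos \<omega> - cos \<theta>\<close> with a weight bounded by 2.\<close>
    also have "\<dots> = integral {-pi..pi} (\<lambda>\<omega>. (2 * cos (real (h + 1) * \<omega>)) * (cos \<omega> - cos \<theta>) * f \<omega>)"
    proof (rule integral_cong)
      fix \<omega>
      have "cos (real (h + 2) * \<omega>) + cos (real h * \<omega>) = 2 * cos \<omega> * cos (real (h + 1) * \<omega>)"
        using cos_plus_cos[of "real (h + 2) * \<omega>" "real h * \<omega>"] by (simp add: algebra_simps add_divide_distrib)
      then have "(cos (real (h + 2) * \<omega>) + cos (real h * \<omega>)) * f \<omega> = (2 * cos \<omega> * cos (real (h + 1) * \<omega>)) * f \<omega>"
        by simp
      then show "?c (h + 2) \<omega> - (2 * cos \<theta>) * ?c (h + 1) \<omega> + ?c h \<omega>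
          = (2 * cos (real (h + 1) * \<omega>)) * (cos \<omega> - cos \<theta>) * f \<omega>"
        by (simp only: algebra_simps)
    qed
    finally show "\<bar>\<gamma> (h + 2) - 2 * cos \<theta> * \<gamma> (h + 1) + \<gamma> h\<bar> \<le> 2 * \<eta>"
      using le_\<eta>[of "\<lambda>\<omega>. 2 * cos (real (h + 1) * \<omega>)" 2]
      by (simp add: abs_mult continuous_intros)
  qed
  moreover have "4 ^ h * \<eta> \<le> \<delta>" if "h < n" for h
  proof -
    have "4 ^ h * \<eta> \<le> 4 ^ h * (200 * s)" using \<open>\<eta> \<le> 200 * s\<close> by simp
    also have "\<dots> \<le> 4 ^ n * (200 * s)" using that s by (intro mult_right_mono power_increasing) auto
    also have "\<dots> \<le> \<delta>" using s by simp
    finally show ?thesis .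
  qed
  ultimately have moments: "\<bar>\<gamma> h - cos (real h * \<theta>)\<bar> \<le> \<delta>" if "h < n" for h
    using that by (meson order_trans)
  have "f \<in> F_all"
    using f0 f1 cont \<phi>_minus unfolding F_all_def
    by (auto simp: absolutely_integrable_continuous_real f_def ar2_density_def \<phi>_def)
  moreover have "v > 0" using c0 by (simp add: v_def)
  moreover have "1 - of_real (2 * (1 - \<epsilon>) * cos \<theta>) * z - of_real (- (1 - \<epsilon>)\<^sup>2) * z\<^sup>2 \<noteq> 0"
    if "cmod z \<le> 1" for z :: complex
    using ar2_poly_nonzero[of "1 - \<epsilon>" z \<theta>] that \<epsilon> by simp
  ultimately have "f \<in> F_AR2"
    unfolding F_AR2_def f_def by blast
  then show thesis using that cont moments unfolding \<gamma>_def by blast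
qed

section \<open>Covariance matrices and trigonometric polynomials\<close>

definition trig_poly :: "real ^ 'n::{finite,linorder} \<Rightarrow> real \<Rightarrow> complex" where
  "trig_poly x \<theta> = (\<Sum>j\<in>UNIV. of_real (x $ j) * iexp (real (pos j) * \<theta>))"

text \<open>Up to the factor \<open>\<i> ^ k\<close>, this is the derivative of order k of
  \<open>trig_poly x\<close> at 0; it is also the inner product of \<open>x\<close> with the trend
  column of degree k. This double role links the trend to the spectral behaviour near frequency
  0.\<close>

definition moment :: "nat \<Rightarrow> real ^ 'n::{finite,linorder} \<Rightarrow> real" where
  "moment k x = (\<Sum>j\<in>UNIV. x $ j * real (pos j) ^ k)"

text \<open>The covariance matrix that belongs to the spectral measure with mass 1/2 at each of
  \<plusminus>\<theta>.\<close>

definition cos_matrix :: "real \<Rightarrow> real ^ 'n::{finite,linorder} ^ 'n::{finite,linorder}" where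
  "cos_matrix \<theta> = (\<chi> j l. cos ((real (pos j) - real (pos l)) * \<theta>))"

lemma pos_le_card: "pos (j :: 'n::{finite,linorder}) \<le> CARD('n)"
  \<comment> \<open>The fact \<open>pos_def\<close> is the defining equation of \<open>pos\<close>;
    that of the predicate with the same name is \<open>pos_def_def\<close>.\<close>
  unfolding pos_def by (rule card_mono) auto

lemma pos_ge_1: "1 \<le> pos (j :: 'n::{finite,linorder})"
proof -
  have "card {j} \<le> card {i. i \<le> j}" by (rule card_mono) auto
  then show ?thesis by (simp add: pos_def)
qed

lemma pos_less: "i < j \<Longrightarrow> pos (i :: 'n::{finite,linorder}) < pos j"
  unfolding pos_def by (rule psubset_card_mono) (auto simp: psubset_eq set_eq_iff intro: exI[of _ j])

lemma inj_pos: "inj (pos :: 'n::{finite,linorder} \<Rightarrow> nat)"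
  by (rule injI) (metis linorder_neq_iff pos_less)

lemma range_pos: "range (pos :: 'n::{finite,linorder} \<Rightarrow> nat) = {1..CARD('n)}"
proof (rule card_subset_eq)
  show "range (pos :: 'n \<Rightarrow> nat) \<subseteq> {1..CARD('n)}" using pos_le_card pos_ge_1 by fastforce
  show "card (range (pos :: 'n \<Rightarrow> nat)) = card {1..CARD('n)}"
    using card_image[OF inj_pos] by simp
qed simp

text \<open>Vanishing moments remove all Taylor terms below order l. The lemma is used in both
  directions: for residuals the moment of order l = kF - 1 vanishes too, which leaves an upper bound
  of order kF; for the contrast it is nonzero, which gives a lower bound of order l.\<close>

lemma trig_poly_approx:
  assumes "\<And>k. k < l \<Longrightarrow> moment k x = 0" and "0 \<le> \<theta>"
  shows "cmod (trig_poly x \<theta> - (\<i> * of_real \<theta>) ^ l / fact l * of_real (moment l x))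
      \<le> (\<Sum>j\<in>UNIV. \<bar>x $ j\<bar> * real (pos j) ^ Suc l) * \<theta> ^ Suc l"
proof -
  define r where "r j = iexp (real (pos j) * \<theta>) - (\<Sum>k\<le>l. (\<i> * of_real (real (pos j) * \<theta>)) ^ k / fact k)" for j :: 'a
  have "(\<Sum>j\<in>UNIV. of_real (x $ j) * (\<Sum>k\<le>l. (\<i> * of_real (real (pos j) * \<theta>)) ^ k / fact k))
      = (\<Sum>k\<le>l. (\<i> * of_real \<theta>) ^ k / fact k * of_real (moment k x))"
    unfolding sum_distrib_left moment_def of_real_sum
    by (subst sum.swap) (simp add: sum_distrib_left power_mult_distrib algebra_simps)
  also have "\<dots> = (\<Sum>k\<in>{l}. (\<i> * of_real \<theta>) ^ k / fact k * of_real (moment k x))"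
    using assms(1) by (intro sum.mono_neutral_right) auto
  finally have "trig_poly x \<theta> - (\<i> * of_real \<theta>) ^ l / fact l * of_real (moment l x)
      = (\<Sum>j\<in>UNIV. of_real (x $ j) * r j)"
    by (simp add: trig_poly_def r_def right_diff_distrib sum_subtractf)
  also have "cmod \<dots> \<le> (\<Sum>j\<in>UNIV. \<bar>x $ j\<bar> * (real (pos j) ^ Suc l * \<theta> ^ Suc l))"
  proof (rule sum_norm_le)
    fix j
    have "cmod (r j) \<le> \<bar>real (pos j) * \<theta>\<bar> ^ Suc l / fact (Suc l)"
      unfolding r_def by (rule iexp_approx1)
    also have "\<dots> \<le> \<bar>real (pos j) * \<theta>\<bar> ^ Suc l / 1"
      by (intro divide_left_mono) (auto simp: fact_ge_1 simp del: fact_Suc)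
    finally show "cmod (of_real (x $ j) * r j) \<le> \<bar>x $ j\<bar> * (real (pos j) ^ Suc l * \<theta> ^ Suc l)"
      using assms(2) by (simp add: norm_mult mult_left_mono power_mult_distrib flip: power_Suc)
  qed
  also have "\<dots> = (\<Sum>j\<in>UNIV. \<bar>x $ j\<bar> * real (pos j) ^ Suc l) * \<theta> ^ Suc l"
    by (simp add: sum_distrib_right mult.assoc)
  finally show ?thesis .
qed

text \<open>The matrix is the real part of a Hermitian matrix of rank one, so its sign and its size
  on given vectors can be read off their trigonometric polynomials.\<close>

lemma inner_cos_matrix: "x \<bullet> (cos_matrix \<theta> *v y) = Re (trig_poly x \<theta> * cnj (trig_poly y \<theta>))"
proof -
  have "trig_poly x \<theta> * cnj (trig_poly y \<theta>)
      = (\<Sum>j\<in>UNIV. \<Sum>l\<in>UNIV. of_real (x $ j * y $ l) * iexp ((real (pos j) - real (pos l)) * \<theta>))"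
    unfolding trig_poly_def cnj_sum sum_product
    by (intro sum.cong refl)
       (simp add: exp_cnj algebra_simps exp_diff exp_minus divide_inverse exp_of_real flip: exp_minus)
  note this[THEN arg_cong[where f = Re]]
  also have "Re (\<Sum>j\<in>UNIV. \<Sum>l\<in>UNIV. of_real (x $ j * y $ l) * iexp ((real (pos j) - real (pos l)) * \<theta>))
      = (\<Sum>j\<in>UNIV. \<Sum>l\<in>UNIV. x $ j * y $ l * cos ((real (pos j) - real (pos l)) * \<theta>))"
    unfolding Re_sum by (simp add: Re_exp)
  finally have "Re (trig_poly x \<theta> * cnj (trig_poly y \<theta>))
      = (\<Sum>j\<in>UNIV. \<Sum>l\<in>UNIV. x $ j * y $ l * cos ((real (pos j) - real (pos l)) * \<theta>))" .
  then show ?thesis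
    by (simp add: inner_vec_def matrix_vector_mult_def cos_matrix_def sum_distrib_left mult_ac)
qed

lemma Sigma_f_nth:
  assumes "continuous_on {-pi..pi} f"
  shows "Sigma_f f $ j $ l = integral {-pi..pi} (\<lambda>\<omega>. cos ((real (pos j) - real (pos l)) * \<omega>) * f \<omega>)"
proof -
  let ?g = "\<lambda>\<omega>. exp (- \<i> * of_real ((real (pos j) - real (pos l)) * \<omega>)) * of_real (f \<omega>)"
  have "?g integrable_on {-pi..pi}"
    by (intro integrable_continuous_interval continuous_intros assms)
  then have "Re (integral {-pi..pi} ?g) = integral {-pi..pi} (\<lambda>\<omega>. Re (?g \<omega>))"
    using integral_linear[OF _ bounded_linear_Re, of ?g "{-pi..pi}"] by (simp add: o_def)
  then show ?thesis by (simp add: Sigma_f_def Re_exp)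
qed

lemma transpose_Sigma_f:
  assumes "continuous_on {-pi..pi} f"
  shows "transpose (Sigma_f f) = Sigma_f f"
proof -
  have "cos ((real (pos j) - real (pos l)) * \<omega>) = cos ((real (pos l) - real (pos j)) * \<omega>)" for j l :: 'a and \<omega>
    by (metis cos_minus minus_diff_eq mult_minus_left)
  then show ?thesis by (simp add: vec_eq_iff transpose_def Sigma_f_nth[OF assms])
qed

lemma inner_Sigma_f:
  assumes "continuous_on {-pi..pi} f"
  shows "x \<bullet> (Sigma_f f *v y) = integral {-pi..pi} (\<lambda>\<omega>. (x \<bullet> (cos_matrix \<omega> *v y)) * f \<omega>)"
proof -
  let ?h = "\<lambda>j l \<omega>. x $ j * y $ l * (cos ((real (pos j) - real (pos l)) * \<omega>) * f \<omega>)"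
  have int: "?h j l integrable_on {-pi..pi}" for j l
    by (intro integrable_continuous_interval continuous_intros assms)
  have "x \<bullet> (Sigma_f f *v y) = (\<Sum>j\<in>UNIV. \<Sum>l\<in>UNIV. integral {-pi..pi} (?h j l))"
    unfolding integral_mult_right
    by (simp add: inner_vec_def matrix_vector_mult_def Sigma_f_nth[OF assms] sum_distrib_left mult_ac)
  also have "\<dots> = integral {-pi..pi} (\<lambda>\<omega>. \<Sum>j\<in>UNIV. \<Sum>l\<in>UNIV. ?h j l \<omega>)"
    by (simp add: integral_sum integrable_sum int)
  also have "(\<lambda>\<omega>. \<Sum>j\<in>UNIV. \<Sum>l\<in>UNIV. ?h j l \<omega>) = (\<lambda>\<omega>. (x \<bullet> (cos_matrix \<omega> *v y)) * f \<omega>)"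
    by (simp add: fun_eq_iff inner_vec_def matrix_vector_mult_def cos_matrix_def sum_distrib_left
        sum_distrib_right algebra_simps)
  finally show ?thesis .
qed

lemma Sigma_f_nonneg:
  assumes "continuous_on {-pi..pi} f" "\<And>\<omega>. 0 \<le> f \<omega>"
  shows "0 \<le> x \<bullet> (Sigma_f f *v x)"
  unfolding inner_Sigma_f[OF assms(1)]
proof (rule integral_nonneg)
  show "(\<lambda>\<omega>. (x \<bullet> (cos_matrix \<omega> *v x)) * f \<omega>) integrable_on {-pi..pi}"
    unfolding inner_cos_matrix trig_poly_def
    by (intro integrable_continuous_interval continuous_intros assms)
  show "0 \<le> x \<bullet> (cos_matrix \<omega> *v x) * f \<omega>" for \<omega>
    using assms(2) by (simp add: inner_cos_matrix)
qed

section \<open>Mixtures with white noise and their covariance matrices\<close>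

definition mix_noise :: "real \<Rightarrow> (real \<Rightarrow> real) \<Rightarrow> real \<Rightarrow> real" where
  "mix_noise c f = (\<lambda>\<omega>. if \<omega> \<in> {-pi..pi} then (1 - c) * f \<omega> + c / (2 * pi) else 0)"

lemma mix_noise_in_F_AR2_ext: "f \<in> F_AR2 \<Longrightarrow> 0 \<le> c \<Longrightarrow> c \<le> 1 \<Longrightarrow> mix_noise c f \<in> F_AR2_ext"
  unfolding F_AR2_ext_def mix_noise_def by (intro CollectI exI[of _ "1 - c"] exI[of _ c] exI[of _ f]) auto

lemma continuous_on_mix_noise:
  assumes "continuous_on {-pi..pi} f"
  shows "continuous_on {-pi..pi} (mix_noise c f)"
proof (rule continuous_on_eq)
  show "continuous_on {-pi..pi} (\<lambda>\<omega>. (1 - c) * f \<omega> + c / (2 * pi))"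
    by (intro continuous_intros assms) auto
qed (simp add: mix_noise_def)

lemma integral_cos_multiple: "integral {-pi..pi} (\<lambda>\<omega>. cos ((real a - real b) * \<omega>)) = (if a = b then 2 * pi else 0)"
proof (cases "a = b")
  case False
  then have d: "real a - real b \<noteq> 0" by simp
  have "((\<lambda>\<omega>. cos ((real a - real b) * \<omega>)) has_integral
      sin ((real a - real b) * pi) / (real a - real b) - sin ((real a - real b) * (-pi)) / (real a - real b)) {-pi..pi}"
    using d
    by (intro fundamental_theorem_of_calculus)
       (auto intro!: derivative_eq_intros simp flip: has_real_derivative_iff_has_vector_derivative)
  moreover have "sin ((real a - real b) * pi) = 0"
    by (simp add: left_diff_distrib sin_diff)
  ultimately show ?thesis using False by (simp add: integral_unique)
qed simp

lemma Sigma_f_mix_noise: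
  assumes "continuous_on {-pi..pi} f"
  shows "Sigma_f (mix_noise c f) = (1 - c) *\<^sub>R Sigma_f f + c *\<^sub>R (mat 1 :: real ^ 'n::{finite,linorder} ^ 'n::{finite,linorder})"
proof -
  have "Sigma_f (mix_noise c f) $ j $ l
      = (1 - c) * Sigma_f f $ j $ l + c * (if j = l then 1 else 0)" for j l :: 'n
  proof -
    let ?c = "\<lambda>\<omega>. cos ((real (pos j) - real (pos l)) * \<omega>)"
    have "Sigma_f (mix_noise c f) $ j $ l = integral {-pi..pi} (\<lambda>\<omega>. (1 - c) * (?c \<omega> * f \<omega>) + c / (2 * pi) * ?c \<omega>)"
      unfolding Sigma_f_nth[OF continuous_on_mix_noise[OF assms]]
      by (rule integral_cong) (simp add: mix_noise_def algebra_simps)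
    also have "\<dots> = (1 - c) * Sigma_f f $ j $ l + c / (2 * pi) * integral {-pi..pi} ?c"
      unfolding Sigma_f_nth[OF assms] integral_mult_right[symmetric]
      by (rule integral_add; intro integrable_continuous_interval continuous_intros assms)
    finally show ?thesis
      by (simp add: integral_cos_multiple inj_eq[OF inj_pos])
  qed
  then show ?thesis by (simp add: vec_eq_iff mat_def)
qed

lemma abs_inner_matrix_le:
  fixes A :: "real ^ 'n ^ 'm"
  assumes "\<And>j l. \<bar>A $ j $ l\<bar> \<le> \<delta>"
  shows "\<bar>x \<bullet> (A *v y)\<bar> \<le> \<delta> * ((\<Sum>j\<in>UNIV. \<bar>x $ j\<bar>) * (\<Sum>l\<in>UNIV. \<bar>y $ l\<bar>))"
proof -
  have "x \<bullet> (A *v y) = (\<Sum>j\<in>UNIV. \<Sum>l\<in>UNIV. A $ j $ l * (x $ j * y $ l))"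
    by (simp add: inner_vec_def matrix_vector_mult_def sum_distrib_left mult_ac)
  also have "\<bar>\<dots>\<bar> \<le> (\<Sum>j\<in>UNIV. \<Sum>l\<in>UNIV. \<delta> * (\<bar>x $ j\<bar> * \<bar>y $ l\<bar>))"
    by (intro order_trans[OF sum_abs] sum_mono)
       (auto simp: abs_mult intro!: order_trans[OF sum_abs] sum_mono mult_right_mono assms)
  also have "\<dots> = \<delta> * ((\<Sum>j\<in>UNIV. \<bar>x $ j\<bar>) * (\<Sum>l\<in>UNIV. \<bar>y $ l\<bar>))"
    by (simp only: sum_product) (simp add: sum_distrib_left)
  finally show ?thesis .
qed

lemma Sigma_f_near_cos_matrix:
  assumes f: "continuous_on {-pi..pi} f"
    and near: "\<And>h. h < CARD('n::{finite,linorder}) \<Longrightarrow>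
      \<bar>integral {-pi..pi} (\<lambda>\<omega>. cos (real h * \<omega>) * f \<omega>) - cos (real h * \<theta>)\<bar> \<le> \<delta>"
  shows "\<bar>(Sigma_f f - cos_matrix \<theta>) $ j $ (l :: 'n::{finite,linorder})\<bar> \<le> \<delta>"
proof -
  define h where "h = nat \<bar>int (pos j) - int (pos l)\<bar>"
  have "real h = \<bar>real (pos j) - real (pos l)\<bar>" by (simp add: h_def)
  then have "real (pos j) - real (pos l) = real h \<or> real (pos j) - real (pos l) = - real h"
    by linarith
  then have cos: "cos ((real (pos j) - real (pos l)) * \<omega>) = cos (real h * \<omega>)" for \<omega>
    by auto
  have "h < CARD('n)"
    using pos_le_card[of j] pos_le_card[of l] pos_ge_1[of j] pos_ge_1[of l] unfolding h_def by linarith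
  from near[OF this] show ?thesis
    by (simp add: Sigma_f_nth[OF f] cos_matrix_def cos)
qed

text \<open>The conclusions speak of bilinear forms only, that is of covariances, and are free of
  any choice of factors. On the range of \<open>P\<close> the autoregressive part is of smaller
  order than \<open>s m\<close>, so that only the noise survives division by
  \<open>s m\<close>.\<close>

lemma ex_spectral_sequence:
  fixes P :: "real ^ 'n::{finite,linorder} ^ 'n::{finite,linorder}"
    and w :: "real ^ 'n::{finite,linorder}"
  assumes P: "transpose P = P" "P ** P = P"
    and PF: "\<And>x k. k < kF \<Longrightarrow> moment k (P *v x) = 0"
    and l: "l < kF" and w: "\<And>k. k < l \<Longrightarrow> moment k w = 0" "moment l w \<noteq> 0"
  obtains F :: "nat \<Rightarrow> real \<Rightarrow> real" and s :: "nat \<Rightarrow> real" where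
    "\<And>m. F m \<in> F_AR2_ext" "\<And>m. 0 < s m"
    "\<And>m. pos_def (Sigma_f (F m) :: real ^ 'n::{finite,linorder} ^ 'n::{finite,linorder})"
    "\<And>x y. (\<lambda>m. (P *v x) \<bullet> (Sigma_f (F m) *v (P *v y)) / s m) \<longlonglongrightarrow> x \<bullet> (P *v y)"
    "filterlim (\<lambda>m. w \<bullet> (Sigma_f (F m) *v w) / s m) at_top sequentially"
proof -
  \<comment> \<open>Starting at 1/2 gives \<open>s m \<le> 1 / 2\<close>, so the weight
    \<open>1 - s m\<close> of the autoregressive part stays at least 1/2.\<close>
  define t where "t m = 1 / (real m + 2)" for m
  have t: "0 < t m" "t m \<le> 1 / 2" for m by (auto simp: t_def field_simps)
  have t0: "t \<longlonglongrightarrow> 0" unfolding t_def by real_asymp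
  have t1: "t m \<le> 1" for m using t(2)[of m] by simp
  \<comment> \<open>The tolerance is \<open>s m * t m\<close> for the noise level \<open>s m\<close>
    chosen below: replacing the point mass by a density costs no more than the residual contribution
    of the point mass itself, and both vanish relative to \<open>s m\<close>.\<close>
  have "\<exists>f. f \<in> F_AR2 \<and> continuous_on {-pi..pi} f \<and> (\<forall>h<CARD('n).
      \<bar>integral {-pi..pi} (\<lambda>\<omega>. cos (real h * \<omega>) * f \<omega>) - cos (real h * t m)\<bar> \<le> t m ^ (2 * kF))" for m
  proof -
    obtain g where "g \<in> F_AR2" "continuous_on {-pi..pi} g" "\<And>h. h < CARD('n) \<Longrightarrow>
      \<bar>integral {-pi..pi} (\<lambda>\<omega>. cos (real h * \<omega>) * g \<omega>) - cos (real h * t m)\<bar> \<le> t m ^ (2 * kF)"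
      using ex_F_AR2_near_point_mass[OF t(1) t1 zero_less_power[OF t(1)]] by metis
    then show ?thesis by blast
  qed
  then obtain f where f: "\<And>m. f m \<in> F_AR2" "\<And>m. continuous_on {-pi..pi} (f m)"
    and near: "\<And>m h. h < CARD('n) \<Longrightarrow>
      \<bar>integral {-pi..pi} (\<lambda>\<omega>. cos (real h * \<omega>) * f m \<omega>) - cos (real h * t m)\<bar> \<le> t m ^ (2 * kF)"
    by metis
  have f0: "0 \<le> f m \<omega>" for m \<omega> using f(1)[of m] by (simp add: F_AR2_def F_all_def)
  define s where "s m = t m ^ (2 * kF - 1)" for m
  have s: "0 < s m" "s m \<le> 1 / 2" for m
  proof -
    show "0 < s m" using t by (simp add: s_def)
    have "s m \<le> t m ^ 1" unfolding s_def using t[of m] t1 l by (intro power_decreasing) (auto simp: less_imp_le)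
    then show "s m \<le> 1 / 2" using t(2)[of m] by simp
  qed
  have s_t: "t m ^ (2 * kF) = s m * t m" for m
    unfolding s_def using l by (cases kF) auto
  define F where "F m = mix_noise (s m) (f m)" for m
  define S :: "nat \<Rightarrow> real ^ 'n::{finite,linorder} ^ 'n::{finite,linorder}" where "S m = Sigma_f (f m)" for m
  define n1 where "n1 x = (\<Sum>j\<in>UNIV. \<bar>x $ j\<bar>)" for x :: "real ^ 'n::{finite,linorder}"
  have SF: "x \<bullet> (Sigma_f (F m) *v y) = (1 - s m) * (x \<bullet> (S m *v y)) + s m * (x \<bullet> y)" for m x y
    by (simp add: F_def Sigma_f_mix_noise[OF f(2)] S_def matrix_vector_mult_add_rdistrib inner_add_right
        scaleR_matrix_vector_assoc[symmetric])
  have S0: "0 \<le> x \<bullet> (S m *v x)" for m x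
    unfolding S_def by (rule Sigma_f_nonneg[OF f(2) f0])
  have S_near: "\<bar>x \<bullet> (S m *v y) - Re (trig_poly x (t m) * cnj (trig_poly y (t m)))\<bar> \<le> s m * t m * (n1 x * n1 y)" for x y m
    using abs_inner_matrix_le[OF Sigma_f_near_cos_matrix[where 'n = 'n, OF f(2) near], of x m y]
    by (simp add: S_def n1_def s_t matrix_vector_mult_diff_rdistrib inner_diff_right inner_cos_matrix)
  define K where "K l x = (\<Sum>j\<in>UNIV. \<bar>x $ j\<bar> * real (pos j) ^ Suc l)" for l and x :: "real ^ 'n::{finite,linorder}"
  have K0: "0 \<le> K l x" for l x by (simp add: K_def sum_nonneg)
  show thesis
  proof (rule that)
    fix m
    show "F m \<in> F_AR2_ext"
      unfolding F_def using s[of m] by (intro mix_noise_in_F_AR2_ext f) auto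
    show "0 < s m" by (rule s)
    have "transpose (Sigma_f (F m)) = (Sigma_f (F m) :: real ^ 'n::{finite,linorder} ^ 'n::{finite,linorder})"
      unfolding F_def by (intro transpose_Sigma_f continuous_on_mix_noise f)
    moreover have "0 < x \<bullet> (Sigma_f (F m) *v x)" if "x \<noteq> 0" for x :: "real ^ 'n::{finite,linorder}"
      using that s[of m] S0[of x m] unfolding SF by (intro add_nonneg_pos mult_nonneg_nonneg) auto
    ultimately show "pos_def (Sigma_f (F m) :: real ^ 'n::{finite,linorder} ^ 'n::{finite,linorder})"
      by (simp add: pos_def_def)
  next
    fix x y
    define C where "C = K (kF - 1) (P *v x) * K (kF - 1) (P *v y) + n1 (P *v x) * n1 (P *v y)"
    have trig: "cmod (trig_poly (P *v z) (t m)) \<le> K (kF - 1) (P *v z) * t m ^ kF" for z m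
      using trig_poly_approx[of "kF - 1" "P *v z" "t m"] PF[of _ z] l t[of m] by (simp add: K_def)
    have bound: "\<bar>(P *v x) \<bullet> (S m *v (P *v y))\<bar> \<le> s m * (C * t m)" for m
    proof -
      have "\<bar>Re (trig_poly (P *v x) (t m) * cnj (trig_poly (P *v y) (t m)))\<bar>
          \<le> cmod (trig_poly (P *v x) (t m) * cnj (trig_poly (P *v y) (t m)))"
        by (rule abs_Re_le_cmod)
      also have "\<dots> \<le> (K (kF - 1) (P *v x) * t m ^ kF) * (K (kF - 1) (P *v y) * t m ^ kF)"
        unfolding norm_mult complex_mod_cnj using K0 t[of m] by (intro mult_mono trig) auto
      also have "\<dots> = K (kF - 1) (P *v x) * K (kF - 1) (P *v y) * (s m * t m)"
        unfolding s_t[symmetric] mult_2 power_add by (simp add: mult_ac)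
      finally show ?thesis
        using S_near[of "P *v x" m "P *v y"] by (simp add: C_def algebra_simps)
    qed
    have lim: "norm ((P *v x) \<bullet> (Sigma_f (F m) *v (P *v y)) / s m - x \<bullet> (P *v y)) \<le> C * t m" for m
    proof -
      have "(P *v x) \<bullet> (P *v y) = x \<bullet> (P *v y)"
        using inner_matrix_vector_mult[of x P "P *v y"] P by (simp add: matrix_vector_mul_assoc)
      then have "(P *v x) \<bullet> (Sigma_f (F m) *v (P *v y)) / s m - x \<bullet> (P *v y)
          = (1 - s m) * (((P *v x) \<bullet> (S m *v (P *v y))) / s m)"
        using s[of m] by (simp add: SF add_divide_distrib)
      also have "\<bar>\<dots>\<bar> \<le> 1 * (s m * (C * t m) / s m)"
        unfolding abs_mult using s[of m] by (intro mult_mono) (use bound[of m] in \<open>auto simp: field_simps\<close>)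
      finally show ?thesis using s[of m] by simp
    qed
    have "(\<lambda>m. (P *v x) \<bullet> (Sigma_f (F m) *v (P *v y)) / s m - x \<bullet> (P *v y)) \<longlonglongrightarrow> 0"
      by (rule Lim_null_comparison[OF always_eventually[OF allI[OF lim]] tendsto_mult_right_zero[OF t0]])
    then show "(\<lambda>m. (P *v x) \<bullet> (Sigma_f (F m) *v (P *v y)) / s m) \<longlonglongrightarrow> x \<bullet> (P *v y)"
      by (rule Lim_null[THEN iffD2])
  next
    \<comment> \<open>Half of the leading Taylor coefficient: the main term is
      \<open>2 * \<kappa> * t m ^ l\<close>, and the remainder eventually consumes at most one half
      of it.\<close>
    define \<kappa> where "\<kappa> = \<bar>moment l w\<bar> / fact l / 2"
    have \<kappa>: "0 < \<kappa>" using w(2) by (simp add: \<kappa>_def)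
    have "(\<lambda>m. K l w * t m) \<longlonglongrightarrow> 0" by (rule tendsto_mult_right_zero[OF t0])
    then have ev: "eventually (\<lambda>m. K l w * t m < \<kappa>) sequentially"
      using \<kappa> by (rule order_tendstoD)
    show "filterlim (\<lambda>m. w \<bullet> (Sigma_f (F m) *v w) / s m) at_top sequentially"
    proof (rule filterlim_at_top_mono)
      \<comment> \<open>The minorant is half of
        \<open>\<kappa>\<^sup>2 / t m - (n1 w)\<^sup>2\<close>: the quotient is a lower bound for
        the point mass after division by \<open>s m\<close>, the subtracted term bounds the
        approximation error, and the factor 1/2 stands for \<open>1 - s m\<close>.\<close>
      show "filterlim (\<lambda>m. (\<kappa>\<^sup>2 * (real m + 2) - (n1 w)\<^sup>2) / 2) at_top sequentially"
        using \<kappa> by real_asymp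
      show "eventually (\<lambda>m. (\<kappa>\<^sup>2 * (real m + 2) - (n1 w)\<^sup>2) / 2 \<le> w \<bullet> (Sigma_f (F m) *v w) / s m) sequentially"
        using ev
      proof eventually_elim
        case (elim m)
        have "cmod ((\<i> * of_real (t m)) ^ l / fact l * of_real (moment l w)) = 2 * \<kappa> * t m ^ l"
          using t[of m] by (simp add: norm_mult norm_divide norm_power \<kappa>_def)
        then have "2 * \<kappa> * t m ^ l \<le> cmod (trig_poly w (t m)) + K l w * t m ^ Suc l"
          using trig_poly_approx[of l w "t m"] w(1) t[of m]
            norm_triangle_sub[of "(\<i> * of_real (t m)) ^ l / fact l * of_real (moment l w)" "trig_poly w (t m)"]
          by (simp add: K_def norm_minus_commute)
        also have "K l w * t m ^ Suc l \<le> \<kappa> * t m ^ l"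
          using elim t[of m] mult_right_mono[of "K l w * t m" \<kappa> "t m ^ l"] by (simp add: mult_ac)
        finally have "\<kappa> * t m ^ l \<le> cmod (trig_poly w (t m))" by simp
        then have "(\<kappa> * t m ^ l)\<^sup>2 \<le> (cmod (trig_poly w (t m)))\<^sup>2"
          using \<kappa> t[of m] by (intro power_mono) auto
        also have "(cmod (trig_poly w (t m)))\<^sup>2 = Re (trig_poly w (t m) * cnj (trig_poly w (t m)))"
          unfolding cmod_power2 by (simp add: power2_eq_square)
        also have "\<dots> \<le> w \<bullet> (S m *v w) + s m * t m * (n1 w)\<^sup>2"
          using S_near[of w m w] by (simp add: power2_eq_square)
        also have "s m * t m * (n1 w)\<^sup>2 \<le> s m * (n1 w)\<^sup>2"
          using s[of m] t[of m] t1[of m] by (intro mult_right_mono) (auto simp: mult_le_cancel_left1)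
        finally have "(\<kappa> * t m ^ l)\<^sup>2 \<le> w \<bullet> (S m *v w) + s m * (n1 w)\<^sup>2" by simp
        moreover have "\<kappa>\<^sup>2 * (s m / t m) \<le> (\<kappa> * t m ^ l)\<^sup>2"
        proof -
          have "s m = t m * t m ^ (2 * kF - 2)"
            unfolding s_def using l by (cases kF) auto
          then have "s m / t m = t m ^ (2 * kF - 2)" using t[of m] by simp
          also have "\<dots> \<le> t m ^ (2 * l)"
            using t[of m] t1[of m] l by (intro power_decreasing) auto
          finally have "\<kappa>\<^sup>2 * (s m / t m) \<le> \<kappa>\<^sup>2 * t m ^ (2 * l)"
            by (intro mult_left_mono) auto
          also have "\<dots> = (\<kappa> * t m ^ l)\<^sup>2"
            by (simp add: power_mult_distrib power_mult mult.commute[of 2 l])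
          finally show ?thesis .
        qed
        ultimately have "\<kappa>\<^sup>2 * (s m / t m) - s m * (n1 w)\<^sup>2 \<le> w \<bullet> (S m *v w)" by simp
        from divide_right_mono[OF this, of "s m"]
        have "\<kappa>\<^sup>2 / t m - (n1 w)\<^sup>2 \<le> w \<bullet> (S m *v w) / s m"
          using s[of m] by (simp add: diff_divide_distrib)
        then have "(\<kappa>\<^sup>2 * (real m + 2) - (n1 w)\<^sup>2) / 2 \<le> (1 / 2) * (w \<bullet> (S m *v w) / s m)"
          by (simp add: t_def)
        also have "\<dots> \<le> (1 - s m) * (w \<bullet> (S m *v w) / s m)"
          using s[of m] S0[of w m] by (intro mult_right_mono) auto
        also have "\<dots> \<le> w \<bullet> (Sigma_f (F m) *v w) / s m"
          using s[of m] by (simp add: SF add_divide_distrib)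
        finally show ?case .
      qed
    qed
  qed
qed

section \<open>Ordinary least squares\<close>

lemma matrix_inv_mult:
  fixes A :: "real ^ 'n ^ 'n"
  assumes "invertible A"
  shows "A ** matrix_inv A = mat 1" "matrix_inv A ** A = mat 1"
  using assms someI_ex[of "\<lambda>B. A ** B = mat 1 \<and> B ** A = mat 1"]
  unfolding invertible_def matrix_inv_def by blast+

lemma matrix_inv_eqI:
  fixes A B :: "real ^ 'n ^ 'n"
  assumes "A ** B = mat 1"
  shows "matrix_inv A = B"
proof -
  have BA: "B ** A = mat 1" using assms by (simp add: matrix_left_right_inverse)
  then have "invertible A" using assms by (auto simp: invertible_def)
  then have "B ** (A ** matrix_inv A) = B" by (simp add: matrix_inv_mult)
  then show ?thesis by (simp add: matrix_mul_assoc BA)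
qed

lemma matrix_inv_scaleR:
  fixes A :: "real ^ 'n ^ 'n"
  assumes "invertible A" "a \<noteq> 0"
  shows "matrix_inv (a *\<^sub>R A) = inverse a *\<^sub>R matrix_inv A"
  using assms by (intro matrix_inv_eqI)
    (simp add: matrix_scalar_ac scalar_matrix_assoc[symmetric] matrix_inv_mult)

lemma invertible_scaleR_iff:
  fixes A :: "real ^ 'n ^ 'n"
  assumes "invertible A"
  shows "invertible (a *\<^sub>R A) \<longleftrightarrow> a \<noteq> 0"
proof
  assume "invertible (a *\<^sub>R A)"
  then have "(a *\<^sub>R A) ** matrix_inv (a *\<^sub>R A) = mat 1" by (rule matrix_inv_mult)
  \<comment> \<open>\<open>undefined\<close> is an arbitrary index: a diagonal entry of the identity
    is 1, whereas it would be 0 if \<open>a = 0\<close>.\<close>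
  from arg_cong[OF this, of "\<lambda>M. M $ undefined $ undefined"]
  show "a \<noteq> 0" by (auto simp: mat_def matrix_matrix_mult_def)
next
  assume "a \<noteq> 0"
  then have "(a *\<^sub>R A) ** (inverse a *\<^sub>R matrix_inv A) = mat 1"
    using assms by (simp add: matrix_scalar_ac scalar_matrix_assoc[symmetric] matrix_inv_mult)
  then show "invertible (a *\<^sub>R A)"
    using invertible_right_inverse by blast
qed

lemma pos_def_invertible:
  assumes "pos_def S"
  shows "invertible S"
proof -
  have "x = 0" if "S *v x = 0" for x
    using assms that by (metis inner_zero_right less_irrefl pos_def_def)
  then show ?thesis
    by (metis invertible_left_inverse matrix_left_invertible_ker)
qed

lemma pos_def_matrix_inv:
  assumes "pos_def S"
  shows "pos_def (matrix_inv S)"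
proof -
  note inv = matrix_inv_mult[OF pos_def_invertible[OF assms]]
  have sym: "transpose S = S" using assms by (simp add: pos_def_def)
  have "S ** transpose (matrix_inv S) = mat 1"
    using arg_cong[OF inv(2), of transpose] by (simp add: matrix_transpose_mul sym)
  then have symi: "transpose (matrix_inv S) = matrix_inv S"
    by (rule matrix_inv_eqI[symmetric])
  have "0 < x \<bullet> (matrix_inv S *v x)" if "x \<noteq> 0" for x
  proof -
    have x: "S *v (matrix_inv S *v x) = x" by (simp add: matrix_vector_mul_assoc inv)
    then have "matrix_inv S *v x \<noteq> 0" using that by auto
    then have "0 < (matrix_inv S *v x) \<bullet> (S *v (matrix_inv S *v x))"
      using assms by (simp add: pos_def_def)
    then show ?thesis by (simp add: x inner_commute)
  qed
  with symi show ?thesis by (simp add: pos_def_def)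
qed

lemma pos_def_congruence:
  fixes B :: "real ^ 'n ^ 'm"
  assumes "pos_def S" and inj: "inj ((*v) (transpose B))"
  shows "pos_def (B ** S ** transpose B)"
proof -
  have "0 < x \<bullet> (B ** S ** transpose B *v x)" if "x \<noteq> 0" for x
  proof -
    have "transpose B *v x \<noteq> 0" using inj that by (metis injD matrix_vector_mult_0_right)
    then have "0 < (transpose B *v x) \<bullet> (S *v (transpose B *v x))" using assms by (simp add: pos_def_def)
    then show ?thesis by (simp add: inner_matrix_vector_mult[of x B] flip: matrix_vector_mul_assoc)
  qed
  then show ?thesis
    using assms(1) by (simp add: pos_def_def matrix_transpose_mul matrix_mul_assoc)
qed

lemma pos_def_gram:
  fixes X :: "real ^ 'k ^ 'n"
  assumes "inj ((*v) X)"
  shows "pos_def (transpose X ** X)"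
proof -
  have "pos_def (mat 1 :: real ^ 'n ^ 'n)" by (simp add: pos_def_def)
  from pos_def_congruence[OF this, of "transpose X"] assms show ?thesis by simp
qed

lemma inj_transpose_if_surj:
  fixes R :: "real ^ 'k ^ 'q"
  assumes "surj ((*v) R)"
  shows "inj ((*v) (transpose R))"
  using assms by (simp add: full_rank_injective[symmetric] full_rank_surjective[symmetric] rank_transpose)

text \<open>The inverse form is nonnegative at \<open>d - t *\<^sub>R (S *v v)\<close>, and
  \<open>t\<close> is its minimizer. The inequality reduces divergence of the Wald form to
  divergence of one linear functional \<open>v\<close> of its argument.\<close>

lemma pos_def_Cauchy_Schwarz:
  assumes "pos_def S"
  shows "(v \<bullet> d)\<^sup>2 \<le> (v \<bullet> (S *v v)) * (d \<bullet> (matrix_inv S *v d))"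
proof (cases "v = 0")
  case False
  let ?J = "matrix_inv S"
  have J: "pos_def ?J" using assms by (rule pos_def_matrix_inv)
  have vSv: "0 < v \<bullet> (S *v v)" using assms False by (simp add: pos_def_def)
  define t where "t = (v \<bullet> d) / (v \<bullet> (S *v v))"
  define e where "e = d - t *\<^sub>R (S *v v)"
  have JS: "?J *v (S *v v) = v"
    by (simp add: matrix_vector_mul_assoc matrix_inv_mult pos_def_invertible[OF assms])
  have "(S *v v) \<bullet> (?J *v d) = v \<bullet> d"
    using inner_matrix_vector_mult[of "S *v v" ?J d] J JS by (simp add: pos_def_def)
  then have "e \<bullet> (?J *v e) = d \<bullet> (?J *v d) - 2 * t * (v \<bullet> d) + t\<^sup>2 * (v \<bullet> (S *v v))"
    by (simp add: e_def matrix_vector_mult_diff_distrib matrix_vector_mult_scaleR JS inner_diff_left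
        inner_diff_right inner_commute[of d v] inner_commute[of "S *v v" v] power2_eq_square algebra_simps)
  moreover have "0 \<le> e \<bullet> (?J *v e)"
    using J by (cases "e = 0") (auto simp: pos_def_def less_imp_le)
  moreover have "t * (v \<bullet> (S *v v)) = v \<bullet> d" using vSv by (simp add: t_def)
  ultimately have "t * (v \<bullet> d) \<le> d \<bullet> (?J *v d)" by (simp add: power2_eq_square mult.assoc)
  then show ?thesis using vSv by (simp add: t_def power2_eq_square field_simps)
qed simp

section \<open>Least squares fits and residuals as linear maps\<close>

definition ols_matrix :: "real ^ 'k ^ 'n \<Rightarrow> real ^ 'n ^ 'k" where
  "ols_matrix X = matrix_inv (transpose X ** X) ** transpose X"

text \<open>For \<open>X\<close> of full column rank this is the orthogonal projection onto the
  complement of span(X), as \<open>proj_matrix_orth_colspan\<close> shows. The explicit formula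
  makes residuals linear in \<open>y\<close> by construction.\<close>

definition residual_matrix :: "real ^ 'k ^ 'n \<Rightarrow> real ^ 'n ^ 'n" where
  "residual_matrix X = mat 1 - X ** ols_matrix X"

lemma hat_beta_eq: "hat_beta X y = ols_matrix X *v y"
  by (simp add: hat_beta_def ols_matrix_def matrix_vector_mul_assoc)

lemma hat_u_eq: "hat_u X y = residual_matrix X *v y"
  by (simp add: hat_u_def hat_beta_eq residual_matrix_def matrix_vector_mult_diff_rdistrib matrix_vector_mul_assoc)

lemma residual_plus_fit: "residual_matrix X *v y + X *v (ols_matrix X *v y) = y"
  using hat_u_eq[of X y] by (metis diff_add_cancel hat_beta_eq hat_u_def)

lemma ols_matrix_mult:
  assumes "inj ((*v) X)"
  shows "ols_matrix X ** X = mat 1"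
  using matrix_inv_mult(2)[OF pos_def_invertible[OF pos_def_gram[OF assms]]]
  by (simp add: ols_matrix_def matrix_mul_assoc)

lemma residual_matrix_mult:
  assumes "inj ((*v) X)"
  shows "residual_matrix X *v (X *v b) = 0"
proof -
  have "X *v (ols_matrix X *v (X *v b)) = X *v b"
    by (simp add: matrix_vector_mul_assoc[of "ols_matrix X"] ols_matrix_mult[OF assms])
  then show ?thesis using residual_plus_fit[of X "X *v b"] by simp
qed

lemma transpose_residual_matrix:
  assumes "inj ((*v) X)"
  shows "transpose (residual_matrix X) = residual_matrix X"
  using pos_def_matrix_inv[OF pos_def_gram[OF assms]]
  by (simp add: residual_matrix_def ols_matrix_def transpose_minus matrix_transpose_mul matrix_mul_assoc pos_def_def)

lemma residual_matrix_idem: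
  assumes "inj ((*v) X)"
  shows "residual_matrix X ** residual_matrix X = residual_matrix X"
proof -
  have "residual_matrix X *v (residual_matrix X *v y) = residual_matrix X *v y" for y
    using residual_matrix_mult[OF assms, of "ols_matrix X *v y"] residual_plus_fit[of X y]
    by (metis add.right_neutral matrix_vector_right_distrib)
  then show ?thesis by (simp add: matrix_eq flip: matrix_vector_mul_assoc)
qed

lemma colspan_eq_range: "colspan X = range ((*v) X)"
proof
  have "columns X \<subseteq> range ((*v) X)" by (auto simp: columns_image_basis)
  then show "colspan X \<subseteq> range ((*v) X)"
    unfolding colspan_def by (intro span_minimal linear_subspace_image) auto
  show "range ((*v) X) \<subseteq> colspan X"
    unfolding colspan_def using matrix_vector_mult_in_columnspace by blast
qed

lemma proj_matrix_orth_colspan: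
  fixes X :: "real ^ 'k ^ 'n"
  assumes "inj ((*v) X)"
  shows "proj_matrix ((colspan X)\<^sup>\<bottom>) = residual_matrix X"
proof -
  let ?L = "(colspan X)\<^sup>\<bottom>" and ?P = "residual_matrix X"
  have "orth_proj ?L x = ?P *v x" for x
    unfolding orth_proj_def
  proof (rule the_equality)
    have "(X *v b) \<bullet> (?P *v x) = 0" for b
      using inner_matrix_vector_mult[of "X *v b" ?P x]
      by (simp add: transpose_residual_matrix[OF assms] residual_matrix_mult[OF assms])
    then have "?P *v x \<in> ?L"
      by (auto simp: orthogonal_comp_def orthogonal_def colspan_eq_range)
    moreover have "x - ?P *v x \<in> colspan X"
      using residual_plus_fit[of X x] by (metis add_diff_cancel_left' colspan_eq_range rangeI)
    then have "x - ?P *v x \<in> ?L\<^sup>\<bottom>" using orthogonal_comp_subset by blast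
    ultimately show P: "?P *v x \<in> ?L \<and> x - ?P *v x \<in> ?L\<^sup>\<bottom>" ..
    fix p assume p: "p \<in> ?L \<and> x - p \<in> ?L\<^sup>\<bottom>"
    have "p - ?P *v x \<in> ?L"
      using p P subspace_diff[OF subspace_orthogonal_comp] by blast
    moreover have "(x - ?P *v x) - (x - p) \<in> ?L\<^sup>\<bottom>"
      using p P subspace_diff[OF subspace_orthogonal_comp] by blast
    ultimately have "p - ?P *v x \<in> ?L \<inter> ?L\<^sup>\<bottom>" by simp
    then show "p = ?P *v x"
      using orthogonal_Int_0[OF subspace_orthogonal_comp, of "colspan X"] by auto
  qed
  then have "orth_proj ?L = (*v) ?P" by auto
  then show ?thesis by (simp add: proj_matrix_def)
qed

lemma omega_hat_eq:
  fixes X :: "real ^ 'k ^ 'n"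
  assumes "inj ((*v) X)"
  shows "omega_hat X W y = (y \<bullet> ((residual_matrix X ** W ** residual_matrix X) *v y)) / CARD('n)"
  using inner_matrix_vector_mult[of y "residual_matrix X"]
  by (simp add: omega_hat_def hat_u_eq transpose_residual_matrix[OF assms] flip: matrix_vector_mul_assoc)

section \<open>The test statistic\<close>

lemma transpose_scaled_orthogonal:
  fixes A :: "real ^ 'n ^ 'n"
  assumes "A ** transpose A = a *\<^sub>R mat 1" "0 < a"
  shows "orthogonal_matrix ((1 / sqrt a) *\<^sub>R A)"
proof -
  have "((1 / sqrt a) *\<^sub>R A) ** transpose ((1 / sqrt a) *\<^sub>R A) = mat 1"
    using assms by (simp add: transpose_scalar matrix_scalar_ac scalar_matrix_assoc[symmetric])
  then show ?thesis
    by (simp add: orthogonal_matrix_def matrix_left_right_inverse)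
qed

text \<open>Whichever factor the choice returns, it is \<open>sqrt a\<close> times an orthogonal
  matrix, and rotation invariance removes the latter.\<close>

lemma gaussian_scaled_identity:
  fixes \<mu> :: "real ^ 'n"
  assumes "0 < a"
  shows "gaussian \<mu> (a *\<^sub>R mat 1) = distr std_gaussian borel (\<lambda>z. \<mu> + sqrt a *\<^sub>R z)"
proof -
  define A :: "real ^ 'n ^ 'n" where "A = (SOME A. A ** transpose A = a *\<^sub>R mat 1)"
  have "(sqrt a *\<^sub>R mat 1 :: real ^ 'n ^ 'n) ** transpose (sqrt a *\<^sub>R mat 1) = a *\<^sub>R mat 1"
    using assms by (simp add: transpose_scalar matrix_scalar_ac scalar_matrix_assoc[symmetric])
  then have A: "A ** transpose A = a *\<^sub>R mat 1" unfolding A_def by (rule someI)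
  define Q where "Q = (1 / sqrt a) *\<^sub>R A"
  have Q: "orthogonal_matrix Q" unfolding Q_def using A assms by (rule transpose_scaled_orthogonal)
  have AQ: "A *v z = sqrt a *\<^sub>R (Q *v z)" for z
    using assms by (simp add: Q_def scaleR_matrix_vector_assoc[symmetric])
  have "distr std_gaussian borel (\<lambda>z. \<mu> + sqrt a *\<^sub>R z)
      = distr (distr std_gaussian borel ((*v) Q)) borel (\<lambda>z. \<mu> + sqrt a *\<^sub>R z)"
    by (simp add: std_gaussian_distr_orthogonal[OF Q])
  also have "\<dots> = distr std_gaussian borel ((\<lambda>z. \<mu> + sqrt a *\<^sub>R z) \<circ> (*v) Q)"
    by (rule distr_distr) auto
  also have "((\<lambda>z. \<mu> + sqrt a *\<^sub>R z) \<circ> (*v) Q) = (\<lambda>z. \<mu> + A *v z)"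
    by (simp add: fun_eq_iff AQ)
  finally show ?thesis by (simp add: gaussian_def A_def)
qed

lemma gaussian_standard: "gaussian 0 (mat 1) = (std_gaussian :: (real ^ 'n) measure)"
  using gaussian_scaled_identity[of 1 "0 :: real ^ 'n"] by (simp add: distr_id2)

lemma measure_std_gaussian_orthogonal:
  fixes Q :: "real ^ 'n ^ 'n"
  assumes "orthogonal_matrix Q" and [measurable]: "S \<in> sets borel"
  shows "measure std_gaussian {z. Q *v z \<in> S} = measure std_gaussian S"
  using measure_distr[of "(*v) Q" std_gaussian borel S]
  by (simp add: std_gaussian_distr_orthogonal[OF assms(1)] vimage_def)

lemma measure_gaussian:
  fixes B :: "real ^ 'n ^ 'n"
  assumes [measurable]: "S \<in> sets borel"
  shows "measure (gaussian \<mu> B) S = measure std_gaussian {z. \<mu> + (SOME A :: real ^ 'n ^ 'n. A ** transpose A = B) *v z \<in> S}"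
  unfolding gaussian_def by (subst measure_distr) (auto simp: vimage_def)

lemma prob_space_gaussian: "prob_space (gaussian \<mu> B)"
  unfolding gaussian_def by (intro prob_space.prob_space_distr prob_space_std_gaussian) simp

lemma measure_gaussian_le_1: "measure (gaussian \<mu> B) S \<le> 1"
  by (rule prob_space.prob_le_1[OF prob_space_gaussian])

lemma measure_std_gaussian_mono_null:
  fixes A :: "(real ^ 'n) set"
  assumes "A \<subseteq> B \<union> Z" "B \<in> sets borel" "Z \<in> null_sets lborel"
  shows "measure std_gaussian A \<le> measure std_gaussian B"
proof -
  interpret prob_space "std_gaussian :: (real ^ 'n) measure" by (rule prob_space_std_gaussian)
  have Z: "Z \<in> null_sets std_gaussian" using assms(3) by (rule null_sets_std_gaussian)
  have "measure std_gaussian A \<le> measure std_gaussian (B \<union> Z)"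
    using assms Z by (intro finite_measure_mono) auto
  also have "\<dots> = measure std_gaussian B"
    using assms Z by (intro measure_Un_null_set) auto
  finally show ?thesis .
qed

lemma continuous_on_matrix_vector_mult [continuous_intros]:
  fixes A :: "real ^ 'n ^ 'm"
  assumes "continuous_on S g"
  shows "continuous_on S (\<lambda>x. A *v g x)"
  by (rule continuous_on_compose2[OF matrix_vector_mult_linear_continuous_on assms]) auto

text \<open>Both covariance estimators are \<open>omega_hat\<close> times
  \<open>exp (c * h y)\<close> times the same fixed matrix and differ only in \<open>h\<close> and
  \<open>N\<close>. Of \<open>h\<close> the axioms keep continuity off \<open>N\<close> and
  invariance under scaling and translation along span(X). The values \<open>r\<close> and
  \<open>c\<close> enter through the definitions below, so the predicate
  \<open>adjusted_test\<close> does not take them as arguments.\<close>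

locale adjusted_test =
  fixes X :: "real ^ 'k ^ 'n" and R :: "real ^ 'k ^ 'q" and r :: "real ^ 'q"
    and W :: "real ^ 'n ^ 'n" and N :: "(real ^ 'n) set" and h :: "real ^ 'n \<Rightarrow> real" and c :: real
  assumes inj_X: "inj ((*v) X)" and surj_R: "surj ((*v) R)" and W_sym: "transpose W = W"
    and PWP: "residual_matrix X ** W ** residual_matrix X \<noteq> 0"
    and subspace_N: "subspace N" and N_proper: "N \<noteq> UNIV" and range_X: "range ((*v) X) \<subseteq> N"
    and cont_h: "continuous_on (- N) h"
    and h_inv: "\<And>y \<delta> \<eta>. y \<notin> N \<Longrightarrow> \<delta> \<noteq> 0 \<Longrightarrow> h (\<delta> *\<^sub>R y + X *v \<eta>) = h y"
begin

definition Mid :: "real ^ 'q ^ 'q" where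
  "Mid = R ** matrix_inv (transpose X ** X) ** transpose R"

definition k :: "real ^ 'n \<Rightarrow> real" where
  "k y = omega_hat X W y * exp (c * h y)"

definition Omega :: "real ^ 'n \<Rightarrow> real ^ 'q ^ 'q" where
  "Omega y = k y *\<^sub>R Mid"

definition T :: "real ^ 'n \<Rightarrow> real" where
  "T = T_stat R r (hat_beta X) Omega N"

definition wald :: "real ^ 'q \<Rightarrow> real" where
  "wald d = d \<bullet> (matrix_inv Mid *v d)"

lemma Mid: "pos_def Mid"
  unfolding Mid_def
  by (intro pos_def_congruence pos_def_matrix_inv pos_def_gram inj_X inj_transpose_if_surj surj_R)

lemma wald_nonneg: "0 \<le> wald d" and wald_pos: "d \<noteq> 0 \<Longrightarrow> 0 < wald d"
  using pos_def_matrix_inv[OF Mid] unfolding wald_def pos_def_def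
  by (cases "d = 0"; auto simp: less_imp_le)+

lemma wald_scaleR: "wald (a *\<^sub>R d) = a\<^sup>2 * wald d"
  by (simp add: wald_def matrix_vector_mult_scaleR power2_eq_square)

lemma hat_u_shift: "hat_u X (\<delta> *\<^sub>R y + X *v \<eta>) = \<delta> *\<^sub>R hat_u X y"
  by (simp add: hat_u_eq matrix_vector_right_distrib matrix_vector_mult_scaleR residual_matrix_mult[OF inj_X])

lemma hat_beta_shift: "hat_beta X (\<delta> *\<^sub>R y + X *v \<eta>) = \<delta> *\<^sub>R hat_beta X y + \<eta>"
  using ols_matrix_mult[OF inj_X]
  by (simp add: hat_beta_eq matrix_vector_right_distrib matrix_vector_mult_scaleR matrix_vector_mul_assoc)

lemma omega_shift: "omega_hat X W (\<delta> *\<^sub>R y + X *v \<eta>) = \<delta>\<^sup>2 * omega_hat X W y"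
  by (simp add: omega_hat_def hat_u_shift matrix_vector_mult_scaleR power2_eq_square)

lemma shift_notin_N:
  assumes "y \<notin> N" "\<delta> \<noteq> 0"
  shows "\<delta> *\<^sub>R y + X *v \<eta> \<notin> N"
proof
  assume "\<delta> *\<^sub>R y + X *v \<eta> \<in> N"
  then have "\<delta> *\<^sub>R y + X *v \<eta> - X *v \<eta> \<in> N"
    using range_X by (intro subspace_diff[OF subspace_N]) auto
  then have "inverse \<delta> *\<^sub>R \<delta> *\<^sub>R y \<in> N"
    using subspace_scale[OF subspace_N, of "\<delta> *\<^sub>R y" "inverse \<delta>"] by simp
  with assms show False by simp
qed

lemma k_shift: "y \<notin> N \<Longrightarrow> \<delta> \<noteq> 0 \<Longrightarrow> k (\<delta> *\<^sub>R y + X *v \<eta>) = \<delta>\<^sup>2 * k y"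
  by (simp add: k_def omega_shift h_inv)

lemma continuous_omega [continuous_intros]: "continuous_on S (omega_hat X W)"
  unfolding omega_hat_def hat_u_eq by (intro continuous_intros) auto

lemma continuous_hat_beta [continuous_intros]: "continuous_on S (hat_beta X)"
  unfolding hat_beta_eq by (intro continuous_intros)

lemma continuous_k: "continuous_on (- N) k"
  unfolding k_def by (intro continuous_intros cont_h)

lemma closed_N: "closed N"
  by (rule closed_subspace[OF subspace_N])

lemma omega_borel [measurable]: "omega_hat X W \<in> borel_measurable borel"
  by (intro borel_measurable_continuous_onI continuous_omega)

lemma null_N: "N \<in> null_sets lborel"
  by (rule null_sets_subspace[OF subspace_N N_proper])

lemma null_omega_zero: "{y. omega_hat X W y = 0} \<in> null_sets lborel"
  using null_sets_quadratic_form[OF _ PWP] W_sym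
  by (simp add: omega_hat_eq[OF inj_X] matrix_transpose_mul transpose_residual_matrix[OF inj_X] matrix_mul_assoc)

lemma det_Omega: "det (Omega y) = 0 \<longleftrightarrow> omega_hat X W y = 0"
  using invertible_scaleR_iff[OF pos_def_invertible[OF Mid]]
  by (simp add: Omega_def invertible_det_nz k_def)

lemma T_eq:
  assumes "y \<notin> N" "omega_hat X W y \<noteq> 0"
  shows "T y = wald (R *v hat_beta X y - r) / k y"
proof -
  have "k y \<noteq> 0" using assms by (simp add: k_def)
  then have "matrix_inv (Omega y) = inverse (k y) *\<^sub>R matrix_inv Mid"
    unfolding Omega_def by (intro matrix_inv_scaleR pos_def_invertible Mid)
  then show ?thesis
    using assms by (simp add: T_def T_stat_def det_Omega wald_def scaleR_matrix_vector_assoc[symmetric] divide_inverse)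
qed

lemma T_eq_0: "y \<in> N \<or> omega_hat X W y = 0 \<Longrightarrow> T y = 0"
  by (auto simp: T_def T_stat_def det_Omega)

lemma T_borel [measurable]: "T \<in> borel_measurable borel"
proof -
  let ?Z = "N \<union> {y. omega_hat X W y = 0}"
  have "closed ?Z"
    by (intro closed_Un closed_N closed_Collect_eq continuous_omega continuous_on_const)
  moreover have "continuous_on (- ?Z) (\<lambda>y. wald (R *v hat_beta X y - r) / k y)"
    unfolding wald_def
    by (intro continuous_intros continuous_on_subset[OF continuous_k]) (auto simp: k_def)
  ultimately have "(\<lambda>y. if y \<in> ?Z then 0 else wald (R *v hat_beta X y - r) / k y) \<in> borel_measurable borel"
    by (intro borel_measurable_continuous_on_if continuous_on_const) auto
  also have "(\<lambda>y. if y \<in> ?Z then 0 else wald (R *v hat_beta X y - r) / k y) = T"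
    using T_eq T_eq_0 by (auto simp: fun_eq_iff)
  finally show ?thesis .
qed

lemma estimator_conditions:
  assumes "- N \<subseteq> D"
  shows "estimator_conditions X D (hat_beta X) Omega N"
  unfolding estimator_conditions_def
proof (intro conjI allI impI)
  show "continuous_on (- N) Omega"
    unfolding Omega_def by (intro continuous_intros continuous_k)
  show "transpose (Omega y) = Omega y" for y
    using Mid by (simp add: Omega_def transpose_scalar pos_def_def)
  show "AE y in lborel. y \<notin> N \<longrightarrow> det (Omega y) \<noteq> 0"
    using AE_not_in[OF null_omega_zero] by eventually_elim (simp add: det_Omega)
qed (auto simp: assms closed_N null_N shift_notin_N hat_beta_shift Omega_def k_shift continuous_hat_beta)

text \<open>Where \<open>omega_hat\<close> is negative and \<open>y\<close> is off \<open>N\<close>,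
  the statistic is nonpositive, so rejection at some \<open>C \<ge> 0\<close> forces its numerator
  to vanish. That confines \<open>z\<close> to an affine null set; points with
  \<open>omega_hat\<close> equal to 0 are already counted on the right-hand side.\<close>

lemma rejection_prob_le:
  assumes "0 \<le> C" "0 < a"
  shows "measure (gaussian (X *v b) (a *\<^sub>R mat 1)) {y. C \<le> T y} \<le> measure std_gaussian {y. omega_hat X W y \<ge> 0}"
proof -
  let ?f = "\<lambda>z. X *v b + sqrt a *\<^sub>R z"
  have "measure (gaussian (X *v b) (a *\<^sub>R mat 1)) {y. C \<le> T y} = measure std_gaussian {z. C \<le> T (?f z)}"
    unfolding gaussian_scaled_identity[OF assms(2)] by (subst measure_distr) (auto simp: vimage_def)
  also have "\<dots> \<le> measure std_gaussian {z. omega_hat X W z \<ge> 0}"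
  proof (rule measure_std_gaussian_mono_null)
    \<comment> \<open>The linear part of the numerator vector as a function of \<open>z\<close>. It
      is nonzero because multiplying \<open>R ** ols_matrix X\<close> by \<open>X\<close> returns
      \<open>R\<close>.\<close>
    define B where "B = sqrt a *\<^sub>R (R ** ols_matrix X)"
    have "B \<noteq> 0"
    proof
      assume "B = 0"
      then have "R ** ols_matrix X = 0" using assms by (simp add: B_def)
      moreover have "R ** ols_matrix X ** X = R"
        by (simp add: ols_matrix_mult[OF inj_X] flip: matrix_mul_assoc)
      ultimately have "R *v x = 0" for x by (metis matrix_vector_mul_assoc matrix_vector_mult_0)
      with surj_R show False
        by (metis surjD one_neq_zero)
    qed
    show "N \<union> {z. B *v z = r - R *v b} \<in> null_sets lborel"
      by (intro null_sets.Un null_N null_sets_affine_equation \<open>B \<noteq> 0\<close>)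
    show "{z. C \<le> T (?f z)} \<subseteq> {z. omega_hat X W z \<ge> 0} \<union> (N \<union> {z. B *v z = r - R *v b})"
    proof safe
      fix z assume z: "C \<le> T (?f z)" "z \<notin> N" "\<not> 0 \<le> omega_hat X W z"
      have f: "?f z = sqrt a *\<^sub>R z + X *v b" by (simp add: add.commute)
      have N: "?f z \<notin> N" unfolding f using z(2) assms by (intro shift_notin_N) auto
      have k: "k (?f z) < 0" "omega_hat X W (?f z) \<noteq> 0"
        unfolding f using z assms by (auto simp: k_shift k_def omega_shift mult_less_0_iff mult_pos_neg)
      have "0 \<le> wald (R *v hat_beta X (?f z) - r) / k (?f z)"
        using z(1) assms(1) T_eq[OF N k(2)] by simp
      then have "wald (R *v hat_beta X (?f z) - r) \<le> 0"
        using k(1) by (simp add: zero_le_divide_iff)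
      then have "R *v hat_beta X (?f z) - r = 0"
        using wald_pos by fastforce
      then show "B *v z = r - R *v b"
        unfolding f hat_beta_shift
        by (simp add: hat_beta_eq B_def matrix_vector_right_distrib matrix_vector_mult_scaleR
            matrix_vector_mul_assoc algebra_simps flip: scaleR_matrix_vector_assoc)
    qed
  qed auto
  finally show ?thesis .
qed

end

section \<open>The size bound\<close>

text \<open>Fatou's lemma for indicator functions: \<open>D n\<close> collects the points of
  \<open>F\<close> that stay in all \<open>E m\<close> from index n on, and these sets increase to
  \<open>F\<close>.\<close>

lemma measure_le_if_eventually:
  fixes M :: "'a measure" and E :: "nat \<Rightarrow> 'a set"
  assumes "finite_measure M" and sets: "F \<in> sets M" "\<And>m. E m \<in> sets M"
    and ev: "\<And>z. z \<in> F \<Longrightarrow> eventually (\<lambda>m. z \<in> E m) sequentially"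
    and le: "\<And>m. measure M (E m) \<le> B"
  shows "measure M F \<le> B"
proof -
  interpret finite_measure M by fact
  define D where "D n = F \<inter> (\<Inter>m\<in>{n..}. E m)" for n
  have D: "D n \<in> sets M" for n
    unfolding D_def using sets by (intro sets.Int sets.countable_INT') auto
  have "incseq D" by (auto simp: D_def incseq_def)
  moreover have "(\<Union>n. D n) = F"
  proof (intro equalityI subsetI)
    fix x assume "x \<in> F"
    then obtain n where "\<forall>m\<ge>n. x \<in> E m" using ev eventually_sequentially by metis
    with \<open>x \<in> F\<close> have "x \<in> D n" by (simp add: D_def)
    then show "x \<in> (\<Union>n. D n)" by blast
  qed (auto simp: D_def)
  ultimately have "(\<lambda>n. measure M (D n)) \<longlonglongrightarrow> measure M F"
    using finite_Lim_measure_incseq[of D] D by auto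
  moreover have "measure M (D n) \<le> B" for n
  proof -
    have "measure M (D n) \<le> measure M (E n)"
      using sets by (intro finite_measure_mono) (auto simp: D_def)
    then show ?thesis using le[of n] by linarith
  qed
  ultimately show ?thesis by (intro LIMSEQ_le_const2) auto
qed

text \<open>The diagonal entries of \<open>G m ** transpose (G m)\<close> are the squared norms of
  the rows of \<open>G m\<close>, so convergence of the products bounds the factors. The bounded
  vectors \<open>u m\<close> are included so that one subsequence serves both limits.\<close>

lemma ex_convergent_subseq_gram:
  fixes G :: "nat \<Rightarrow> real ^ 'n ^ 'n" and u :: "nat \<Rightarrow> real ^ 'n"
  assumes lim: "\<And>x y. (\<lambda>m. (transpose (G m) *v x) \<bullet> (transpose (G m) *v y)) \<longlonglongrightarrow> x \<bullet> (P *v y)"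
    and u: "\<And>m. norm (u m) \<le> 1"
  obtains \<rho> B u0 where "strict_mono (\<rho> :: nat \<Rightarrow> nat)" "(\<lambda>m. G (\<rho> m)) \<longlonglongrightarrow> B"
    "(\<lambda>m. u (\<rho> m)) \<longlonglongrightarrow> u0" "B ** transpose B = P"
proof -
  have "\<exists>K. \<forall>m. norm (G m $ i) \<le> K" for i
  proof -
    have "Bseq (\<lambda>m. (transpose (G m) *v axis i 1) \<bullet> (transpose (G m) *v axis i 1))"
      using lim by (intro convergent_imp_Bseq convergentI)
    then obtain K where K: "\<And>m. norm ((transpose (G m) *v axis i 1) \<bullet> (transpose (G m) *v axis i 1)) \<le> K"
      unfolding Bseq_def by auto
    have "transpose (G m) *v axis i 1 = G m $ i" for m
      by (simp add: matrix_vector_mult_basis row_def vec_eq_iff)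
    then have "(norm (G m $ i))\<^sup>2 \<le> K" for m
      using K[of m] by (simp add: power2_norm_eq_inner)
    then have "norm (G m $ i) \<le> sqrt K" for m
      by (simp add: real_le_rsqrt)
    then show ?thesis by blast
  qed
  then obtain K where K: "\<And>i m. norm (G m $ i) \<le> K i" by metis
  have "norm (G m) \<le> (\<Sum>i\<in>UNIV. K i)" for m
    unfolding norm_vec_def[of "G m"] by (rule order_trans[OF L2_set_le_sum sum_mono]) (simp_all add: K)
  then have "norm (G m, u m) \<le> (\<Sum>i\<in>UNIV. K i) + 1" for m
    using norm_Pair_le[of "G m" "u m"] u[of m] by (meson add_mono order_trans)
  then have "bounded (range (\<lambda>m. (G m, u m)))"
    by (auto simp: bounded_iff)
  then obtain l \<rho> where \<rho>: "strict_mono \<rho>" "((\<lambda>m. (G m, u m)) \<circ> \<rho>) \<longlonglongrightarrow> l"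
    using bounded_imp_convergent_subsequence by blast
  from tendsto_fst[OF \<rho>(2)] have B: "(\<lambda>m. G (\<rho> m)) \<longlonglongrightarrow> fst l" by (simp add: o_def)
  from tendsto_snd[OF \<rho>(2)] have u0: "(\<lambda>m. u (\<rho> m)) \<longlonglongrightarrow> snd l" by (simp add: o_def)
  have "x \<bullet> ((fst l ** transpose (fst l)) *v y) = x \<bullet> (P *v y)" for x y
  proof -
    have "(\<lambda>m. (transpose (G (\<rho> m)) *v x) \<bullet> (transpose (G (\<rho> m)) *v y))
        \<longlonglongrightarrow> (transpose (fst l) *v x) \<bullet> (transpose (fst l) *v y)"
      unfolding inner_vec_def matrix_vector_mult_def transpose_def inner_real_def
      by (simp, intro tendsto_intros B)
    moreover have "(\<lambda>m. (transpose (G (\<rho> m)) *v x) \<bullet> (transpose (G (\<rho> m)) *v y)) \<longlonglongrightarrow> x \<bullet> (P *v y)"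
      using LIMSEQ_subseq_LIMSEQ[OF lim \<rho>(1)] by (simp add: o_def)
    ultimately have "(transpose (fst l) *v x) \<bullet> (transpose (fst l) *v y) = x \<bullet> (P *v y)"
      by (rule LIMSEQ_unique)
    then show ?thesis
      by (simp add: inner_matrix_vector_mult[of x "fst l"] flip: matrix_vector_mul_assoc)
  qed
  then have "fst l ** transpose (fst l) = P"
    by (simp add: matrix_eq) (metis vector_eq_ldot)
  with that \<rho>(1) B u0 show thesis by blast
qed

lemma tendsto_matrix_vector_mult:
  fixes G :: "'a \<Rightarrow> real ^ 'n ^ 'm"
  assumes "(G \<longlongrightarrow> B) F"
  shows "((\<lambda>m. G m *v z) \<longlongrightarrow> B *v z) F"
  unfolding matrix_vector_mult_def by (intro tendsto_intros assms)

context adjusted_test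
begin

lemma residual_in_N_iff: "residual_matrix X *v y \<in> N \<longleftrightarrow> y \<in> N"
proof -
  have "y - residual_matrix X *v y \<in> N"
    using range_X residual_plus_fit[of X y] by (metis add_diff_cancel_left' rangeI subsetD)
  from subspace_diff[OF subspace_N _ this, of y] subspace_add[OF subspace_N this, of "residual_matrix X *v y"]
  show ?thesis by auto
qed

lemma omega_residual: "omega_hat X W (residual_matrix X *v y) = omega_hat X W y"
  using omega_shift[of 1 "residual_matrix X *v y" "ols_matrix X *v y"] by (simp add: residual_plus_fit)

text \<open>Relative to \<open>q m\<close> only the residual part of the observation is known to
  converge; its component in span(X) may diverge. But translations along span(X) do not change
  \<open>k\<close>, so \<open>k\<close> can be evaluated at the convergent \<open>g m\<close>.
  Numerator and denominator both carry the square of \<open>q m\<close>, which cancels.\<close>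

lemma T_tends_to_infinity:
  fixes A G :: "nat \<Rightarrow> real ^ 'n ^ 'n" and q :: "nat \<Rightarrow> real"
  assumes b: "R *v b = r" and q: "\<And>m. 0 < q m"
    and G: "\<And>m. G m = (1 / q m) *\<^sub>R (residual_matrix X ** A m)"
    and GB: "G \<longlonglongrightarrow> B" and Bz: "B *v z \<notin> N" "0 < omega_hat X W (B *v z)"
    and inf: "filterlim (\<lambda>m. (v \<bullet> ((1 / q m) *\<^sub>R (R *v (ols_matrix X *v (A m *v z)))))\<^sup>2) at_top sequentially"
  shows "eventually (\<lambda>m. C \<le> T (X *v b + A m *v z)) sequentially"
proof -
  define d where "d m = (1 / q m) *\<^sub>R (R *v (ols_matrix X *v (A m *v z)))" for m
  define g where "g m = G m *v z" for m
  have g: "g \<longlonglongrightarrow> B *v z"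
    unfolding g_def by (rule tendsto_matrix_vector_mult[OF GB])
  have qg: "q m *\<^sub>R g m = residual_matrix X *v (A m *v z)" for m
    using q[of m] by (simp add: g_def G scaleR_matrix_vector_assoc[symmetric] matrix_vector_mul_assoc)
  have y: "X *v b + A m *v z = q m *\<^sub>R g m + X *v (b + ols_matrix X *v (A m *v z))" for m
    using residual_plus_fit[of X "A m *v z"] by (simp add: qg matrix_vector_right_distrib algebra_simps)
  have gN: "eventually (\<lambda>m. g m \<in> - N) sequentially"
    using g Bz closed_N by (intro topological_tendstoD) auto
  have "isCont k (B *v z)"
    using continuous_k closed_N Bz(1) by (simp add: continuous_on_eq_continuous_at open_Compl)
  then have kg: "(\<lambda>m. k (g m)) \<longlonglongrightarrow> k (B *v z)"
    using g by (rule isCont_tendsto_compose)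
  have kB: "0 < k (B *v z)" using Bz(2) by (simp add: k_def)
  have kpos: "eventually (\<lambda>m. 0 < k (g m)) sequentially"
    using order_tendstoD(1)[OF kg kB] .
  \<comment> \<open>The added 1 keeps the divisor positive for \<open>v = 0\<close> as well.\<close>
  define \<kappa> where "\<kappa> = v \<bullet> (Mid *v v) + 1"
  have \<kappa>: "0 < \<kappa>" using Mid unfolding \<kappa>_def pos_def_def
    by (cases "v = 0") (auto simp: add_pos_pos)
  have wald_ge: "(v \<bullet> d m)\<^sup>2 / \<kappa> \<le> wald (d m)" for m
  proof -
    have "(v \<bullet> d m)\<^sup>2 \<le> \<kappa> * wald (d m)"
      using pos_def_Cauchy_Schwarz[OF Mid, of v "d m"] wald_nonneg[of "d m"]
      by (simp add: \<kappa>_def wald_def algebra_simps)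
    then show ?thesis using \<kappa> by (simp add: field_simps)
  qed
  have "filterlim (\<lambda>m. 1 / \<kappa> * (v \<bullet> d m)\<^sup>2) at_top sequentially"
    using inf \<kappa> by (intro filterlim_tendsto_pos_mult_at_top[OF tendsto_const]) (auto simp: d_def)
  then have wald_inf: "filterlim (\<lambda>m. wald (d m)) at_top sequentially"
    by (rule filterlim_at_top_mono) (use wald_ge in auto)
  have "(\<lambda>m. 1 / k (g m)) \<longlonglongrightarrow> 1 / k (B *v z)"
    using kB by (intro tendsto_intros kg) auto
  then have "filterlim (\<lambda>m. 1 / k (g m) * wald (d m)) at_top sequentially"
    using kB wald_inf by (intro filterlim_tendsto_pos_mult_at_top[where c = "1 / k (B *v z)"]) auto
  then have "eventually (\<lambda>m. C \<le> 1 / k (g m) * wald (d m)) sequentially"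
    by (simp add: filterlim_at_top)
  then show ?thesis using gN kpos
  proof eventually_elim
    case (elim m)
    let ?y = "X *v b + A m *v z"
    have yN: "?y \<notin> N" unfolding y using elim q[of m] by (intro shift_notin_N) auto
    have ky: "k ?y = (q m)\<^sup>2 * k (g m)"
      unfolding y using elim q[of m] by (intro k_shift) auto
    have "k ?y \<noteq> 0" using ky elim q[of m] by auto
    then have om: "omega_hat X W ?y \<noteq> 0" by (auto simp: k_def)
    have "R *v hat_beta X ?y - r = q m *\<^sub>R d m"
      using ols_matrix_mult[OF inj_X] b q[of m]
      by (simp add: hat_beta_eq d_def matrix_vector_right_distrib matrix_vector_mul_assoc)
    then have "T ?y = wald (d m) / k (g m)"
      using q[of m] by (simp add: T_eq[OF yN om] wald_scaleR ky)
    then show ?case using elim by simp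
  qed
qed

text \<open>The vector \<open>w\<close> represents the functional \<open>v\<close> of R \<beta> in
  terms of the observation. For fixed \<open>z\<close> the scaled functional is
  \<open>\<alpha> m \<bullet> z\<close>, where the squared norm of \<open>\<alpha> m\<close> is the
  diverging variance ratio. If the directions of \<open>\<alpha> m\<close> tend to
  \<open>u0\<close>, the functional is unbounded at every \<open>z\<close> not orthogonal to
  \<open>u0\<close>. A bound \<open>p\<close> for all \<open>m\<close>, instead of a supremum, keeps
  spectral densities out of the argument.\<close>

lemma size_ge:
  fixes S :: "nat \<Rightarrow> real ^ 'n ^ 'n" and s :: "nat \<Rightarrow> real" and v :: "real ^ 'q"
  defines "w \<equiv> transpose (ols_matrix X) *v (transpose R *v v)"
  assumes S: "\<And>m. pos_def (S m)" and s: "\<And>m. 0 < s m"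
    and lim: "\<And>x y. (\<lambda>m. (residual_matrix X *v x) \<bullet> (S m *v (residual_matrix X *v y)) / s m)
      \<longlonglongrightarrow> x \<bullet> (residual_matrix X *v y)"
    and inf: "filterlim (\<lambda>m. w \<bullet> (S m *v w) / s m) at_top sequentially"
    and a: "0 < a" and b: "R *v b = r"
    and le: "\<And>m. measure (gaussian (X *v b) (a *\<^sub>R S m)) {y. C \<le> T y} \<le> p"
  shows "measure std_gaussian {y. omega_hat X W y \<ge> 0} \<le> p"
proof -
  let ?P = "residual_matrix X"
  note Psym = transpose_residual_matrix[OF inj_X]
  define A :: "nat \<Rightarrow> real ^ 'n ^ 'n" where "A m = (SOME A. A ** transpose A = a *\<^sub>R S m)" for m
  have A: "A m ** transpose (A m) = a *\<^sub>R S m" for m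
  proof -
    have "pos_def (a *\<^sub>R S m)"
      using S[of m] a by (simp add: pos_def_def transpose_scalar scaleR_matrix_vector_assoc[symmetric])
    from someI_ex[OF pos_def_eq_mult_transpose[OF this]] show ?thesis by (simp add: A_def)
  qed
  have AA: "(transpose (A m) *v x) \<bullet> (transpose (A m) *v y) = a * (x \<bullet> (S m *v y))" for m x y
    using inner_matrix_vector_mult[of x "A m" "transpose (A m) *v y"]
    by (simp add: matrix_vector_mul_assoc A scaleR_matrix_vector_assoc[symmetric])
  define q where "q m = sqrt (a * s m)" for m
  have q: "0 < q m" "q m * q m = a * s m" for m
    using a s[of m] by (simp_all add: q_def)
  define G where "G m = (1 / q m) *\<^sub>R (?P ** A m)" for m
  define \<alpha> where "\<alpha> m = (1 / q m) *\<^sub>R (transpose (A m) *v w)" for m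
  \<comment> \<open>Division by zero yields \<open>u m = 0\<close> if \<open>\<alpha> m = 0\<close>.
    Since the norms of \<open>\<alpha> m\<close> diverge, \<open>u m\<close> is a unit vector from
    some index on, so the limit \<open>u0\<close> is nonzero.\<close>
  define u where "u m = (1 / norm (\<alpha> m)) *\<^sub>R \<alpha> m" for m
  have Gt: "transpose (G m) *v x = (1 / q m) *\<^sub>R (transpose (A m) *v (?P *v x))" for m x
    by (simp add: G_def transpose_scalar matrix_transpose_mul Psym scaleR_matrix_vector_assoc[symmetric]
        matrix_vector_mul_assoc)
  have "(transpose (G m) *v x) \<bullet> (transpose (G m) *v y) = (?P *v x) \<bullet> (S m *v (?P *v y)) / s m" for m x y
    using a q[of m] s[of m] by (simp add: Gt AA)
  then have limG: "(\<lambda>m. (transpose (G m) *v x) \<bullet> (transpose (G m) *v y)) \<longlonglongrightarrow> x \<bullet> (?P *v y)" for x y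
    using lim[of x y] by simp
  have u1: "norm (u m) \<le> 1" for m by (simp add: u_def)
  obtain \<rho> B u0 where \<rho>: "strict_mono \<rho>" and B: "(\<lambda>m. G (\<rho> m)) \<longlonglongrightarrow> B"
    and u0: "(\<lambda>m. u (\<rho> m)) \<longlonglongrightarrow> u0" and BP: "B ** transpose B = ?P"
    using ex_convergent_subseq_gram[of G ?P u] limG u1 by blast
  obtain Q where Q: "orthogonal_matrix Q" "B = ?P ** Q"
    using projection_eq_mult_orthogonal[OF Psym residual_matrix_idem[OF inj_X] BP] by blast
  have "(norm (\<alpha> m))\<^sup>2 = w \<bullet> (S m *v w) / s m" for m
  proof -
    have "\<alpha> m \<bullet> \<alpha> m = a * (w \<bullet> (S m *v w)) / (q m * q m)"
      by (simp add: \<alpha>_def AA)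
    then show ?thesis using a s[of m] by (simp add: power2_norm_eq_inner q(2))
  qed
  then have \<alpha>_inf: "filterlim (\<lambda>m. (norm (\<alpha> (\<rho> m)))\<^sup>2) at_top sequentially"
    using filterlim_compose[OF inf filterlim_subseq[OF \<rho>]] by simp
  have "u0 \<noteq> 0"
  proof
    assume "u0 = 0"
    then have "(\<lambda>m. norm (u (\<rho> m))) \<longlonglongrightarrow> 0" using u0 tendsto_norm_zero by blast
    then have "eventually (\<lambda>m. norm (u (\<rho> m)) < 1) sequentially" by (rule order_tendstoD) simp
    moreover have "eventually (\<lambda>m. 1 \<le> (norm (\<alpha> (\<rho> m)))\<^sup>2) sequentially"
      using \<alpha>_inf by (simp add: filterlim_at_top)
    ultimately have "eventually (\<lambda>m. False) sequentially"
      by eventually_elim (auto simp: u_def split: if_splits)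
    then show False by simp
  qed
  \<comment> \<open>The good set in terms of the rotated variable y = Q z, for which
    \<open>(Q *v u0) \<bullet> y\<close> equals \<open>u0 \<bullet> z\<close>. It differs from the
    set where \<open>omega_hat\<close> is nonnegative by null sets only, and the rotation preserves
    its probability.\<close>
  define F where "F = {y. y \<notin> N \<and> 0 < omega_hat X W y \<and> (Q *v u0) \<bullet> y \<noteq> 0}"
  have [measurable]: "N \<in> sets borel" using closed_N by simp
  have F[measurable]: "F \<in> sets borel"
    unfolding F_def by measurable
  have QQ: "(Q *v x) \<bullet> (Q *v y) = x \<bullet> y" for x y
    using Q(1) by (metis orthogonal_transformation_def orthogonal_transformation_matrix
        matrix_of_matrix_vector_mul matrix_vector_mul_linear)
  have "measure std_gaussian {y. omega_hat X W y \<ge> 0} \<le> measure std_gaussian F"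
  proof (rule measure_std_gaussian_mono_null)
    have "Q *v u0 \<notin> {y. (Q *v u0) \<bullet> y = 0}" using \<open>u0 \<noteq> 0\<close> by (simp add: QQ)
    then have "{y. (Q *v u0) \<bullet> y = 0} \<noteq> UNIV" by blast
    then show "{y. omega_hat X W y = 0} \<union> (N \<union> {y. (Q *v u0) \<bullet> y = 0}) \<in> null_sets lborel"
      by (intro null_sets.Un null_omega_zero null_N null_sets_subspace subspace_hyperplane)
  qed (auto simp: F_def)
  also have "\<dots> = measure std_gaussian {z. Q *v z \<in> F}"
    by (rule measure_std_gaussian_orthogonal[symmetric, OF Q(1) F])
  also have "\<dots> \<le> p"
  proof (rule measure_le_if_eventually)
    show "finite_measure (std_gaussian :: (real ^ 'n) measure)"
      using prob_space_std_gaussian by (rule prob_space.finite_measure)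
    show "{z. Q *v z \<in> F} \<in> sets std_gaussian" by measurable
    show "{z. C \<le> T (X *v b + A (\<rho> m) *v z)} \<in> sets std_gaussian" for m by measurable
    show "measure std_gaussian {z. C \<le> T (X *v b + A (\<rho> m) *v z)} \<le> p" for m
      using le[of "\<rho> m"] by (subst (asm) measure_gaussian) (auto simp: A_def)
    fix z assume "z \<in> {z. Q *v z \<in> F}"
    then have z: "Q *v z \<notin> N" "0 < omega_hat X W (Q *v z)" "u0 \<bullet> z \<noteq> 0"
      by (auto simp: F_def QQ)
    have "eventually (\<lambda>m. C \<le> T (X *v b + A (\<rho> m) *v z)) sequentially"
    proof (rule T_tends_to_infinity[OF b q(1) G_def B])
      have Bz: "B *v z = ?P *v (Q *v z)" by (simp add: Q(2) matrix_vector_mul_assoc)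
      show "B *v z \<notin> N" "0 < omega_hat X W (B *v z)"
        using z by (simp_all add: Bz residual_in_N_iff omega_residual)
      have \<alpha>_z: "\<alpha> m \<bullet> z = v \<bullet> ((1 / q m) *\<^sub>R (R *v (ols_matrix X *v (A m *v z))))" for m
        by (simp add: \<alpha>_def w_def inner_matrix_vector_mult)
      have "(\<lambda>m. (u (\<rho> m) \<bullet> z)\<^sup>2) \<longlonglongrightarrow> (u0 \<bullet> z)\<^sup>2"
        by (intro tendsto_intros u0)
      then have "filterlim (\<lambda>m. (u (\<rho> m) \<bullet> z)\<^sup>2 * (norm (\<alpha> (\<rho> m)))\<^sup>2) at_top sequentially"
        using z(3) \<alpha>_inf by (intro filterlim_tendsto_pos_mult_at_top[where c = "(u0 \<bullet> z)\<^sup>2"]) auto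
      moreover have "(u m \<bullet> z)\<^sup>2 * (norm (\<alpha> m))\<^sup>2 = (\<alpha> m \<bullet> z)\<^sup>2" for m
        by (cases "\<alpha> m = 0") (simp_all add: u_def power_divide)
      ultimately show "filterlim (\<lambda>m. (v \<bullet> ((1 / q (\<rho> m)) *\<^sub>R (R *v (ols_matrix X *v (A (\<rho> m) *v z)))))\<^sup>2) at_top sequentially"
        by (simp add: \<alpha>_z)
    qed
    then show "eventually (\<lambda>m. z \<in> {z. C \<le> T (X *v b + A (\<rho> m) *v z)}) sequentially" by simp
  qed
  finally show ?thesis .
qed

end

section \<open>Polynomial trends and the two covariance estimators\<close>

lemma moment_eq_inner_column:
  fixes X :: "real ^ 'k::{finite,linorder} ^ 'n::{finite,linorder}"
  assumes "polynomial_trend X R kF" "pos j \<le> kF"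
  shows "moment (pos j - 1) y = y \<bullet> (X *v axis j 1)"
  using assms by (simp add: moment_def polynomial_trend_def matrix_vector_mult_basis column_def inner_vec_def)

lemma ex_pos_eq:
  assumes "1 \<le> i" "i \<le> CARD('k::{finite,linorder})"
  obtains j :: "'k::{finite,linorder}" where "pos j = i"
  using assms range_pos[where 'n = 'k] by (metis atLeastAtMost_iff imageE)

lemma moment_residual:
  fixes X :: "real ^ 'k::{finite,linorder} ^ 'n::{finite,linorder}"
  assumes "polynomial_trend X R kF" "inj ((*v) X)" "l < kF"
  shows "moment l (residual_matrix X *v y) = 0"
proof -
  have "1 \<le> Suc l" "Suc l \<le> CARD('k)" using assms by (auto simp: polynomial_trend_def)
  then obtain j :: 'k where j: "pos j = Suc l" using ex_pos_eq[where 'k = 'k] by blast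
  then have "moment l (residual_matrix X *v y) = (X *v axis j 1) \<bullet> (residual_matrix X *v y)"
    using moment_eq_inner_column[OF assms(1), of j] assms(3) by (simp add: inner_commute)
  also have "\<dots> = 0"
    by (simp add: inner_matrix_vector_mult[of _ "residual_matrix X"] transpose_residual_matrix[OF assms(2)]
        residual_matrix_mult[OF assms(2)])
  finally show ?thesis .
qed

text \<open>As \<open>ols_matrix X\<close> is a left inverse of \<open>X\<close>, the moment of
  order \<open>pos j - 1\<close> of the contrast is \<open>v \<bullet> column j R\<close>. Taking
  for \<open>v\<close> the first nonzero column of \<open>R\<close> makes all earlier moments vanish
  and the next one a positive squared norm.\<close>

lemma polynomial_trend_contrast:
  fixes X :: "real ^ 'k::{finite,linorder} ^ 'n::{finite,linorder}"
    and R :: "real ^ 'k::{finite,linorder} ^ 'q"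
  assumes trend: "polynomial_trend X R kF" and inj: "inj ((*v) X)"
  obtains v l where "l < kF"
    "\<And>k. k < l \<Longrightarrow> moment k (transpose (ols_matrix X) *v (transpose R *v v)) = 0"
    "moment l (transpose (ols_matrix X) *v (transpose R *v v)) \<noteq> 0"
proof -
  define Z where "Z = {i. pos i \<le> kF \<and> column i R \<noteq> 0}"
  have "Z \<noteq> {}" using trend by (auto simp: Z_def polynomial_trend_def)
  then have "Min Z \<in> Z" and min: "\<And>j. j \<in> Z \<Longrightarrow> Min Z \<le> j" by auto
  define i where "i = Min Z"
  have i: "pos i \<le> kF" "column i R \<noteq> 0" using \<open>Min Z \<in> Z\<close> by (auto simp: Z_def i_def)
  define v where "v = column i R"
  have eq: "moment (pos j - 1) (transpose (ols_matrix X) *v (transpose R *v v)) = v \<bullet> column j R"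
    if "pos j \<le> kF" for j
  proof -
    have "ols_matrix X *v (X *v axis j 1) = axis j 1"
      by (simp add: matrix_vector_mul_assoc ols_matrix_mult[OF inj])
    then show ?thesis
      using moment_eq_inner_column[OF trend that, of "transpose (ols_matrix X) *v (transpose R *v v)"]
        inner_matrix_vector_mult[of "transpose R *v v" "ols_matrix X" "X *v axis j 1"]
        inner_matrix_vector_mult[of v R "axis j 1"]
      by (simp add: matrix_vector_mult_basis)
  qed
  show thesis
  proof (rule that[of "pos i - 1" v])
    show "pos i - 1 < kF" using i pos_ge_1[of i] by simp
    show "moment (pos i - 1) (transpose (ols_matrix X) *v (transpose R *v v)) \<noteq> 0"
      using eq[OF i(1)] i(2) by (simp add: v_def)
    fix l assume l: "l < pos i - 1"
    have "1 \<le> Suc l" "Suc l \<le> CARD('k)" using l pos_le_card[of i] by auto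
    then obtain j :: 'k where j: "pos j = Suc l" using ex_pos_eq[where 'k = 'k] by blast
    then have "pos j < pos i" using l by simp
    then have "j < i" by (metis linorder_neq_iff not_less_iff_gr_or_eq pos_less)
    then have "j \<notin> Z" using min[of j] leD unfolding i_def by blast
    then have "column j R = 0" using \<open>pos j < pos i\<close> i by (auto simp: Z_def)
    then show "moment l (transpose (ols_matrix X) *v (transpose R *v v)) = 0"
      using eq[of j] j \<open>pos j < pos i\<close> i by simp
  qed
qed

lemma (in adjusted_test) SUP_rejection_prob_le:
  assumes "0 \<le> C"
  shows "(SUP \<mu>1\<in>M1 X R r. SUP sig2\<in>{0<..}. measure (gaussian \<mu>1 (sig2 *\<^sub>R mat 1)) {y. T y \<ge> C})
    \<le> measure (gaussian 0 (mat 1)) {y. omega_hat X W y \<ge> 0}"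
proof (rule cSUP_least)
  \<comment> \<open>A bound on the terms bounds a real supremum only over a nonempty index set;
    surjectivity of \<open>R\<close> provides a point of the alternative.\<close>
  obtain b where "R *v b = r + (\<chi> i. 1)" using surj_R by (metis surjD)
  then have "R *v b \<noteq> r" by (auto simp: vec_eq_iff)
  then show "M1 X R r \<noteq> {}" by (auto simp: M1_def)
  fix \<mu>1 assume "\<mu>1 \<in> M1 X R r"
  then obtain b where b: "\<mu>1 = X *v b" by (auto simp: M1_def)
  show "(SUP sig2\<in>{0<..}. measure (gaussian \<mu>1 (sig2 *\<^sub>R mat 1)) {y. T y \<ge> C})
      \<le> measure (gaussian 0 (mat 1)) {y. omega_hat X W y \<ge> 0}"
    unfolding gaussian_standard b
    by (rule cSUP_least) (auto intro: rejection_prob_le[OF assms])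
qed

lemma adjusted_test_size_SUP_ge:
  fixes X :: "real ^ 'k::{finite,linorder} ^ 'n::{finite,linorder}"
    and R :: "real ^ 'k::{finite,linorder} ^ 'q"
  assumes "adjusted_test X R W N h" and trend: "polynomial_trend X R kF"
    and FF: "F_AR2_ext \<subseteq> FF" and "\<mu>0 \<in> M0 X R r" "0 < a"
  shows "measure (gaussian 0 (mat 1)) {y. omega_hat X W y \<ge> 0}
    \<le> (SUP f\<in>FF. measure (gaussian \<mu>0 (a *\<^sub>R Sigma_f f)) {y. adjusted_test.T X R r W N h c y \<ge> C})"
proof -
  interpret adjusted_test X R r W N h c by fact
  obtain b where b: "\<mu>0 = X *v b" "R *v b = r" using assms(4) by (auto simp: M0_def)
  obtain v l where v: "l < kF"
    "\<And>k. k < l \<Longrightarrow> moment k (transpose (ols_matrix X) *v (transpose R *v v)) = 0"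
    "moment l (transpose (ols_matrix X) *v (transpose R *v v)) \<noteq> 0"
    using polynomial_trend_contrast[OF trend inj_X] by blast
  obtain F s where F: "\<And>m. F m \<in> F_AR2_ext" "\<And>m. 0 < s m"
    "\<And>m. pos_def (Sigma_f (F m) :: real ^ 'n::{finite,linorder} ^ 'n::{finite,linorder})"
    "\<And>x y. (\<lambda>m. (residual_matrix X *v x) \<bullet> (Sigma_f (F m) *v (residual_matrix X *v y)) / s m)
        \<longlonglongrightarrow> x \<bullet> (residual_matrix X *v y)"
    "filterlim (\<lambda>m. (transpose (ols_matrix X) *v (transpose R *v v)) \<bullet>
        (Sigma_f (F m) *v (transpose (ols_matrix X) *v (transpose R *v v))) / s m) at_top sequentially"
    using ex_spectral_sequence[OF transpose_residual_matrix[OF inj_X] residual_matrix_idem[OF inj_X]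
        moment_residual[OF trend inj_X] v] by blast
  show ?thesis
    unfolding gaussian_standard b(1)
  proof (rule size_ge[OF F(3,2,4,5) assms(5) b(2)])
    fix m
    show "measure (gaussian (X *v b) (a *\<^sub>R Sigma_f (F m))) {y. C \<le> T y}
        \<le> (SUP f\<in>FF. measure (gaussian (X *v b) (a *\<^sub>R Sigma_f f)) {y. C \<le> T y})"
      \<comment> \<open>Probabilities are bounded by 1, so the real supremum is an upper bound of
        its terms.\<close>
      using F(1)[of m] FF by (intro cSUP_upper) (auto intro!: bdd_aboveI2[where M = 1] measure_gaussian_le_1)
  qed
qed

section \<open>The two covariance estimators as instances of the abstract test\<close>

lemma colspan_neq_UNIV:
  fixes Z :: "real ^ 'l ^ 'n"
  assumes "CARD('l) < CARD('n)"
  shows "colspan Z \<noteq> UNIV"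
proof
  assume "colspan Z = UNIV"
  then have "rank Z = CARD('n)"
    using rank_dim_range[of Z] by (simp add: colspan_eq_range)
  then show False using rank_bound[of Z] assms by simp
qed

lemma subspace_colspan: "subspace (colspan Z)"
  by (simp add: colspan_def)

lemma hat_u_zero_imp: "hat_u Z y = 0 \<Longrightarrow> y \<in> colspan Z"
  using residual_plus_fit[of Z y] by (simp add: hat_u_eq colspan_eq_range) (metis rangeI)

text \<open>The exponent is a multiple of a Rayleigh quotient of the residuals: numerator and
  denominator scale alike, and the denominator is nonzero off span(X).\<close>

lemma adjusted_test_BV:
  fixes X :: "real ^ 'k ^ 'n::{finite,linorder}"
  assumes "CARD('k) < CARD('n)" "inj ((*v) X)" "surj ((*v) R)" "transpose W = W"
    and "residual_matrix X ** W ** residual_matrix X \<noteq> 0"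
  shows "adjusted_test X R W (colspan X) (\<lambda>y. 1 / (real CARD('n))\<^sup>2 *
           ((hat_u X y \<bullet> ((transpose A_mat ** A_mat) *v hat_u X y)) / (hat_u X y \<bullet> hat_u X y)))"
proof
  show "continuous_on (- colspan X) (\<lambda>y. 1 / (real CARD('n))\<^sup>2 *
      ((hat_u X y \<bullet> ((transpose A_mat ** A_mat) *v hat_u X y)) / (hat_u X y \<bullet> hat_u X y)))"
    using hat_u_zero_imp[of X] unfolding hat_u_eq
    by (intro continuous_intros) auto
  show "1 / (real CARD('n))\<^sup>2 * ((hat_u X (\<delta> *\<^sub>R y + X *v \<eta>) \<bullet> ((transpose A_mat ** A_mat) *v hat_u X (\<delta> *\<^sub>R y + X *v \<eta>)))
        / (hat_u X (\<delta> *\<^sub>R y + X *v \<eta>) \<bullet> hat_u X (\<delta> *\<^sub>R y + X *v \<eta>)))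
      = 1 / (real CARD('n))\<^sup>2 * ((hat_u X y \<bullet> ((transpose A_mat ** A_mat) *v hat_u X y)) / (hat_u X y \<bullet> hat_u X y))"
    if "\<delta> \<noteq> 0" for y \<delta> \<eta>
  proof -
    have "hat_u X (\<delta> *\<^sub>R y + X *v \<eta>) = \<delta> *\<^sub>R hat_u X y"
      by (simp add: hat_u_eq matrix_vector_right_distrib matrix_vector_mult_scaleR residual_matrix_mult[OF assms(2)])
    then show ?thesis using that by (simp add: matrix_vector_mult_scaleR)
  qed
  show "range ((*v) X) \<subseteq> colspan X" by (simp add: colspan_eq_range)
qed (use assms in \<open>auto simp: colspan_neq_UNIV subspace_colspan\<close>)

lemma sum_UNIV_sum:
  "(\<Sum>j\<in>(UNIV :: ('a::finite + 'b::finite) set). f j) = (\<Sum>a\<in>UNIV. f (Inl a)) + (\<Sum>b\<in>UNIV. f (Inr b))"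
  using sum.Plus[of "UNIV :: 'a set" "UNIV :: 'b set" f] by simp

lemma append_cols_mult:
  "append_cols X U *v (\<chi> j. case j of Inl a \<Rightarrow> b $ a | Inr _ \<Rightarrow> 0) = X *v b"
  by (simp add: matrix_vector_mult_def append_cols_def vec_eq_iff sum_UNIV_sum)

lemma G_mat_mult: "(G_mat :: real ^ ('k::finite + 'm::finite) ^ 'm::finite) *v x = (\<chi> i. x $ Inr i)"
  by (simp add: matrix_vector_mult_def G_mat_def vec_eq_iff sum_UNIV_sum if_distrib[of "\<lambda>x. x * _"] cong: if_cong)

context
  fixes X :: "real ^ 'k ^ 'n" and U :: "real ^ 'm ^ 'n"
  assumes inj_Z: "inj ((*v) (append_cols X U))"
begin

lemma pos_def_G_gram:
  "pos_def ((G_mat :: real ^ ('k + 'm) ^ 'm) ** matrix_inv (transpose (append_cols X U) ** append_cols X U)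
    ** transpose G_mat)"
proof (intro pos_def_congruence pos_def_matrix_inv pos_def_gram inj_Z inj_transpose_if_surj)
  have "\<exists>x. y = (G_mat :: real ^ ('k + 'm) ^ 'm) *v x" for y
    by (rule exI[of _ "\<chi> j. case j of Inl a \<Rightarrow> 0 | Inr b \<Rightarrow> y $ b"]) (simp add: G_mat_mult vec_eq_iff)
  then show "surj ((*v) (G_mat :: real ^ ('k + 'm) ^ 'm))" by (simp add: surj_def)
qed

lemma s2_eq: "s2 (append_cols X U) y = (norm (hat_u (append_cols X U) y))\<^sup>2 / CARD('n)"
proof -
  let ?P = "residual_matrix (append_cols X U)"
  have "y \<bullet> (?P *v y) = (?P *v y) \<bullet> (?P *v y)"
    using inner_matrix_vector_mult[of y ?P "?P *v y"]
    by (simp add: matrix_vector_mul_assoc residual_matrix_idem[OF inj_Z] transpose_residual_matrix[OF inj_Z])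
  then show ?thesis
    by (simp add: s2_def proj_matrix_orth_colspan[OF inj_Z] hat_u_eq power2_norm_eq_inner)
qed

lemma s2_nonzero: "y \<notin> colspan (append_cols X U) \<Longrightarrow> s2 (append_cols X U) y \<noteq> 0"
  using hat_u_zero_imp[of "append_cols X U" y] by (auto simp: s2_eq)

text \<open>Pulling \<open>s2\<close> out of the inverse leaves a constant matrix, so J becomes a
  quotient of quadratic forms in \<open>y\<close>; continuity and invariance can then be read off
  without treating an inverse that varies with \<open>y\<close>.\<close>

lemma J_stat_eq:
  assumes "s2 (append_cols X U) y \<noteq> 0"
  shows "J_stat X U y = (let b = (G_mat :: real ^ ('k + 'm) ^ 'm) *v hat_beta (append_cols X U) y in
    (b \<bullet> (matrix_inv ((G_mat :: real ^ ('k + 'm) ^ 'm) **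
        matrix_inv (transpose (append_cols X U) ** append_cols X U) ** transpose G_mat) *v b))
      / (s2 (append_cols X U) y * CARD('n)))"
  using assms
  by (simp add: J_stat_def J_mid_def Let_def matrix_inv_scaleR[OF pos_def_invertible[OF pos_def_G_gram]]
      scaleR_matrix_vector_assoc[symmetric] divide_inverse)

lemma continuous_J_stat: "continuous_on (- colspan (append_cols X U)) (J_stat X U)"
proof (rule continuous_on_eq)
  show "continuous_on (- colspan (append_cols X U)) (\<lambda>y.
    let b = (G_mat :: real ^ ('k + 'm) ^ 'm) *v hat_beta (append_cols X U) y in
    (b \<bullet> (matrix_inv ((G_mat :: real ^ ('k + 'm) ^ 'm) **
        matrix_inv (transpose (append_cols X U) ** append_cols X U) ** transpose G_mat) *v b))
      / (s2 (append_cols X U) y * CARD('n)))"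
    unfolding Let_def hat_beta_eq
  proof (intro continuous_intros)
    show "continuous_on (- colspan (append_cols X U)) (s2 (append_cols X U))"
      unfolding s2_eq hat_u_eq by (intro continuous_intros) auto
  qed (use s2_nonzero in auto)
qed (use s2_nonzero J_stat_eq in auto)

text \<open>A translation by \<open>X *v \<eta>\<close> is one by
  \<open>append_cols X U *v \<zeta>\<close> with zero entries in the block of \<open>U\<close>.
  \<open>G_mat\<close> selects just that block and does not see it, and scaling cancels between
  numerator and \<open>s2\<close>.\<close>

lemma J_stat_shift:
  assumes "y \<notin> colspan (append_cols X U)" "\<delta> \<noteq> 0"
  shows "J_stat X U (\<delta> *\<^sub>R y + X *v \<eta>) = J_stat X U y"
proof -
  let ?Z = "append_cols X U"
  define \<zeta> :: "real ^ ('k + 'm)" where "\<zeta> = (\<chi> j. case j of Inl a \<Rightarrow> \<eta> $ a | Inr _ \<Rightarrow> 0)"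
  have X: "X *v \<eta> = ?Z *v \<zeta>" by (simp add: \<zeta>_def append_cols_mult)
  have s2: "s2 ?Z (\<delta> *\<^sub>R y + X *v \<eta>) = \<delta>\<^sup>2 * s2 ?Z y"
    unfolding s2_eq hat_u_eq X
    by (simp add: matrix_vector_right_distrib matrix_vector_mult_scaleR residual_matrix_mult[OF inj_Z]
        power_mult_distrib)
  have G\<zeta>: "(G_mat :: real ^ ('k + 'm) ^ 'm) *v \<zeta> = 0"
    by (simp add: G_mat_mult \<zeta>_def vec_eq_iff)
  have "hat_beta ?Z (\<delta> *\<^sub>R y + X *v \<eta>) = \<delta> *\<^sub>R hat_beta ?Z y + \<zeta>"
    unfolding X hat_beta_eq using ols_matrix_mult[OF inj_Z]
    by (simp add: matrix_vector_right_distrib matrix_vector_mult_scaleR matrix_vector_mul_assoc)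
  then have b: "(G_mat :: real ^ ('k + 'm) ^ 'm) *v hat_beta ?Z (\<delta> *\<^sub>R y + X *v \<eta>)
      = \<delta> *\<^sub>R ((G_mat :: real ^ ('k + 'm) ^ 'm) *v hat_beta ?Z y)"
    by (simp add: matrix_vector_right_distrib matrix_vector_mult_scaleR G\<zeta>)
  show ?thesis
    using s2_nonzero[OF assms(1)] assms(2)
    by (subst (1 2) J_stat_eq) (simp_all add: s2 b Let_def matrix_vector_mult_scaleR power2_eq_square)
qed

text \<open>The exceptional set grows to span(X,U) because \<open>s2\<close>, the denominator of J,
  vanishes there; \<open>omega_hat\<close> still uses the residuals of \<open>X\<close>
  alone.\<close>

lemma adjusted_test_BV_J:
  assumes "CARD('k) + CARD('m) < CARD('n)" "surj ((*v) R)" "transpose W = W" "inj ((*v) X)"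
    and "residual_matrix X ** W ** residual_matrix X \<noteq> 0"
  shows "adjusted_test X R W (colspan (append_cols X U)) (J_stat X U)"
proof
  show "range ((*v) X) \<subseteq> colspan (append_cols X U)"
    unfolding colspan_eq_range using append_cols_mult[of X U] by (metis image_subsetI rangeI)
qed (use assms in \<open>auto simp: colspan_neq_UNIV subspace_colspan continuous_J_stat J_stat_shift\<close>)

lemma subset_dom_BV_J:
  assumes "inj ((*v) X)"
  shows "- colspan (append_cols X U) \<subseteq> dom_BV_J X U"
  using s2_nonzero
  by (auto simp: dom_BV_J_def J_mid_def Let_def pos_def_invertible[OF pos_def_gram[OF assms]]
      pos_def_invertible[OF pos_def_gram[OF inj_Z]] invertible_scaleR_iff[OF pos_def_invertible[OF pos_def_G_gram]])

end

theorem corollary5p9: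
  fixes X :: "real ^ 'k::{finite,linorder} ^ 'n::{finite,linorder}"
    and R :: "real ^ 'k::{finite,linorder} ^ 'q" and r :: "real ^ 'q"
    and W :: "real ^ 'n::{finite,linorder} ^ 'n::{finite,linorder}" and c :: real and kF :: nat
    and FF :: "(real \<Rightarrow> real) set"
  assumes "CARD('k) < CARD('n)"
    and "rank X = CARD('k)"
    and "rank R = CARD('q)"
    and "FF \<subseteq> F_all"
    and "F_AR2_ext \<subseteq> FF"
    and "polynomial_trend X R kF"
    and "transpose W = W"
    and "proj_matrix ((colspan X)\<^sup>\<bottom>) ** W ** proj_matrix ((colspan X)\<^sup>\<bottom>) \<noteq> 0"
  shows
    "estimator_conditions X (dom_BV X) (hat_beta X) (Omega_BV X R W c) (colspan X) \<and>
     (\<forall>C::real. \<forall>\<mu>0 \<in> M0 X R r. \<forall>sig2 \<in> {0<..}.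
        measure (gaussian 0 (mat 1)) {y. omega_hat X W y \<ge> 0}
        \<le> (SUP f\<in>FF. measure (gaussian \<mu>0 (sig2 *\<^sub>R Sigma_f f))
              {y. T_stat R r (hat_beta X) (Omega_BV X R W c) (colspan X) y \<ge> C})) \<and>
     (\<forall>C::real. 0 \<le> C \<longrightarrow>
        (SUP \<mu>1\<in>M1 X R r. SUP sig2\<in>{0<..}. measure (gaussian \<mu>1 (sig2 *\<^sub>R mat 1))
              {y. T_stat R r (hat_beta X) (Omega_BV X R W c) (colspan X) y \<ge> C})
        \<le> measure (gaussian 0 (mat 1)) {y. omega_hat X W y \<ge> 0}) \<and>
     (\<forall>U :: real ^ 'm ^ 'n::{finite,linorder}.
        rank (append_cols X U) = CARD('k) + CARD('m) \<and> CARD('k) + CARD('m) < CARD('n) \<longrightarrow>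
        estimator_conditions X (dom_BV_J X U) (hat_beta X) (Omega_BV_J X R W U c)
          (colspan (append_cols X U)) \<and>
        (\<forall>C::real. \<forall>\<mu>0 \<in> M0 X R r. \<forall>sig2 \<in> {0<..}.
           measure (gaussian 0 (mat 1)) {y. omega_hat X W y \<ge> 0}
           \<le> (SUP f\<in>FF. measure (gaussian \<mu>0 (sig2 *\<^sub>R Sigma_f f))
                 {y. T_stat R r (hat_beta X) (Omega_BV_J X R W U c)
                       (colspan (append_cols X U)) y \<ge> C})) \<and>
        (\<forall>C::real. 0 \<le> C \<longrightarrow>
           (SUP \<mu>1\<in>M1 X R r. SUP sig2\<in>{0<..}. measure (gaussian \<mu>1 (sig2 *\<^sub>R mat 1))
                 {y. T_stat R r (hat_beta X) (Omega_BV_J X R W U c)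
                       (colspan (append_cols X U)) y \<ge> C})
           \<le> measure (gaussian 0 (mat 1)) {y. omega_hat X W y \<ge> 0})) \<and>
     (nonneg_definite (proj_matrix ((colspan X)\<^sup>\<bottom>) ** W ** proj_matrix ((colspan X)\<^sup>\<bottom>)) \<longrightarrow>
        measure (gaussian 0 (mat 1)) {y. omega_hat X W y \<ge> 0} = 1)"
proof (intro conjI)
  have inj_X: "inj ((*v) X)" using assms(2) by (simp add: full_rank_injective)
  have surj_R: "surj ((*v) R)" using assms(3) by (simp add: full_rank_surjective)
  have PWP: "residual_matrix X ** W ** residual_matrix X \<noteq> 0"
    using assms(8) by (simp add: proj_matrix_orth_colspan[OF inj_X])
  let ?h = "\<lambda>y. 1 / (real CARD('n))\<^sup>2 *
    ((hat_u X y \<bullet> ((transpose A_mat ** A_mat) *v hat_u X y)) / (hat_u X y \<bullet> hat_u X y))"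
  note BV = adjusted_test_BV[OF assms(1) inj_X surj_R assms(7) PWP]
  interpret BV: adjusted_test X R r W "colspan X" ?h c by (rule BV)
  \<comment> \<open>The two forms differ only in the bracketing of the product in the exponent,
    whence \<open>mult.assoc\<close>.\<close>
  have Omega_BV: "BV.Omega = Omega_BV X R W c"
    unfolding BV.Omega_def[abs_def] BV.k_def BV.Mid_def Omega_BV_def[abs_def] mult.assoc ..
  note T_BV = BV.T_def[unfolded Omega_BV]
  have "- colspan X \<subseteq> dom_BV X"
    using hat_u_zero_imp[of X] pos_def_invertible[OF pos_def_gram[OF inj_X]] by (auto simp: dom_BV_def)
  from BV.estimator_conditions[OF this]
  show "estimator_conditions X (dom_BV X) (hat_beta X) (Omega_BV X R W c) (colspan X)"
    by (simp only: Omega_BV)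
  show "\<forall>C::real. \<forall>\<mu>0 \<in> M0 X R r. \<forall>sig2 \<in> {0<..}.
        measure (gaussian 0 (mat 1)) {y. omega_hat X W y \<ge> 0}
        \<le> (SUP f\<in>FF. measure (gaussian \<mu>0 (sig2 *\<^sub>R Sigma_f f))
              {y. T_stat R r (hat_beta X) (Omega_BV X R W c) (colspan X) y \<ge> C})"
    using adjusted_test_size_SUP_ge[OF BV assms(6,5), where r = r and c = c, unfolded T_BV] by auto
  show "\<forall>C::real. 0 \<le> C \<longrightarrow>
        (SUP \<mu>1\<in>M1 X R r. SUP sig2\<in>{0<..}. measure (gaussian \<mu>1 (sig2 *\<^sub>R mat 1))
              {y. T_stat R r (hat_beta X) (Omega_BV X R W c) (colspan X) y \<ge> C})
        \<le> measure (gaussian 0 (mat 1)) {y. omega_hat X W y \<ge> 0}"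
    using BV.SUP_rejection_prob_le unfolding T_BV by blast
  show "\<forall>U :: real ^ 'm ^ 'n::{finite,linorder}.
        rank (append_cols X U) = CARD('k) + CARD('m) \<and> CARD('k) + CARD('m) < CARD('n) \<longrightarrow>
        estimator_conditions X (dom_BV_J X U) (hat_beta X) (Omega_BV_J X R W U c)
          (colspan (append_cols X U)) \<and>
        (\<forall>C::real. \<forall>\<mu>0 \<in> M0 X R r. \<forall>sig2 \<in> {0<..}.
           measure (gaussian 0 (mat 1)) {y. omega_hat X W y \<ge> 0}
           \<le> (SUP f\<in>FF. measure (gaussian \<mu>0 (sig2 *\<^sub>R Sigma_f f))
                 {y. T_stat R r (hat_beta X) (Omega_BV_J X R W U c)
                       (colspan (append_cols X U)) y \<ge> C})) \<and>
        (\<forall>C::real. 0 \<le> C \<longrightarrow>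
           (SUP \<mu>1\<in>M1 X R r. SUP sig2\<in>{0<..}. measure (gaussian \<mu>1 (sig2 *\<^sub>R mat 1))
                 {y. T_stat R r (hat_beta X) (Omega_BV_J X R W U c)
                       (colspan (append_cols X U)) y \<ge> C})
           \<le> measure (gaussian 0 (mat 1)) {y. omega_hat X W y \<ge> 0})"
  proof (intro allI impI)
    fix U :: "real ^ 'm ^ 'n::{finite,linorder}"
    assume U: "rank (append_cols X U) = CARD('k) + CARD('m) \<and> CARD('k) + CARD('m) < CARD('n)"
    then have inj_Z: "inj ((*v) (append_cols X U))" by (simp add: full_rank_injective[symmetric])
    have "CARD('k) + CARD('m) < CARD('n)" using U by simp
    note J = adjusted_test_BV_J[OF inj_Z this surj_R assms(7) inj_X PWP]
    interpret J: adjusted_test X R r W "colspan (append_cols X U)" "J_stat X U" c by (rule J)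
    have Omega_J: "J.Omega = Omega_BV_J X R W U c"
      unfolding J.Omega_def[abs_def] J.k_def J.Mid_def Omega_BV_J_def[abs_def] ..
    note T_J = J.T_def[unfolded Omega_J]
    show "estimator_conditions X (dom_BV_J X U) (hat_beta X) (Omega_BV_J X R W U c)
          (colspan (append_cols X U)) \<and>
        (\<forall>C::real. \<forall>\<mu>0 \<in> M0 X R r. \<forall>sig2 \<in> {0<..}.
           measure (gaussian 0 (mat 1)) {y. omega_hat X W y \<ge> 0}
           \<le> (SUP f\<in>FF. measure (gaussian \<mu>0 (sig2 *\<^sub>R Sigma_f f))
                 {y. T_stat R r (hat_beta X) (Omega_BV_J X R W U c)
                       (colspan (append_cols X U)) y \<ge> C})) \<and>
        (\<forall>C::real. 0 \<le> C \<longrightarrow>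
           (SUP \<mu>1\<in>M1 X R r. SUP sig2\<in>{0<..}. measure (gaussian \<mu>1 (sig2 *\<^sub>R mat 1))
                 {y. T_stat R r (hat_beta X) (Omega_BV_J X R W U c)
                       (colspan (append_cols X U)) y \<ge> C})
           \<le> measure (gaussian 0 (mat 1)) {y. omega_hat X W y \<ge> 0})"
      using J.estimator_conditions[OF subset_dom_BV_J[OF inj_Z inj_X], unfolded Omega_J]
        adjusted_test_size_SUP_ge[OF J assms(6,5), where r = r and c = c, unfolded T_J]
        J.SUP_rejection_prob_le[unfolded T_J]
      by auto
  qed
  show "nonneg_definite (proj_matrix ((colspan X)\<^sup>\<bottom>) ** W ** proj_matrix ((colspan X)\<^sup>\<bottom>)) \<longrightarrow>
        measure (gaussian 0 (mat 1)) {y. omega_hat X W y \<ge> 0} = 1"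
  proof
    assume "nonneg_definite (proj_matrix ((colspan X)\<^sup>\<bottom>) ** W ** proj_matrix ((colspan X)\<^sup>\<bottom>))"
    then have "{y. omega_hat X W y \<ge> 0} = space (gaussian 0 (mat 1))"
      by (simp add: nonneg_definite_def proj_matrix_orth_colspan[OF inj_X] omega_hat_eq[OF inj_X] gaussian_standard)
    then show "measure (gaussian 0 (mat 1)) {y. omega_hat X W y \<ge> 0} = 1"
      using prob_space.prob_space[OF prob_space_gaussian] by simp
  qed
qed

end
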